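(* Let $p,q$ be coprime positive integers such that $\rho=p/q$ satisfies $0<\rho\le 1/2$. Then the only unimodal over-twist pattern of over-rotation number $\rho$ is the pattern $\gamma_\rho$. Moreover, a unimodal map $f$ has over-rotation interval $I_f=[\mu,1/2]$ with $\mu\le\rho$ if and only if $f$ has a periodic orbit of pattern $\gamma_\rho$.
   Context: **Over-rotation interval.** For a continuous map $f$ of a compact interval into itself put $\chi(x)=1/2$ if $(f(x)-x)(f^2(x)-f(x))\le 0$ and $\chi(x)=0$ otherwise. For a non-fixed periodic point $y$ of (minimal) period $n$ let $l(y)=\sum_{i=0}^{n-1}\chi(f^i(y))$ (an integer); the over-rotation number of $y$ (and of its cycle) is $l(y)/n$. The over-rotation interval $I_f$ is the closure of the set of over-rotation numbers of all non-fixed periodic points of $f$; it is known that if $f$ has a non-fixed periodic point then $I_f=[\rho_f,1/2]$ for some $0\le\rho_f\le 1/2$. **Unimodal maps.** A continuous map $f:[0,1]\to[0,1]$ is unimodal if there is $c\in(0,1)$ with $f(c)=1$, $f(1)=0$, $f$ (strictly) increasing on $[0,c]$ and (strictly) decreasing on $[c,1]$. Standing assumption: $f$ has no fixed points in $[0,c)$. **Patterns.** A pattern is a cyclic permutation of $\{1,\dots,n\}$. A continuous interval map $f$ exhibits the pattern $\pi$ on its cycle $P$ (equivalently, $P$ is a periodic orbit of pattern $\pi$) if $f|_P$ is conjugate to $\pi$ by an increasing bijection. A cyclic permutation of any finite set of reals is identified with the corresponding pattern through the increasing bijection. A pattern $\pi$ forces a pattern $\theta$ if every continuous interval map exhibiting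 $\pi$ also exhibits $\theta$. The over-rotation number of a pattern (with $n\ge2$) is the over-rotation number of any cycle exhibiting it (this depends only on the pattern). A pattern is an over-twist pattern if it does not force any other pattern of the same over-rotation number. A pattern is unimodal if it is exhibited by some unimodal map on one of its cycles. **The pattern $\gamma_\rho$.** For $\rho=p/q$, $p,q$ coprime, $0<\rho\le 1/2$, $\gamma_\rho$ is the pattern of the cyclic permutation $\phi$ of $\{0,1/q,\dots,(q-1)/q\}$ given by: $\phi(j/q)=(j+p)/q$ for $0\le j\le q-2p-1$; $\phi(j/q)=(2q-2p-1-j)/q$ for $q-2p\le j\le q-p-1$; $\phi(j/q)=(q-1-j)/q$ for $q-p\le j\le q-1$. *)

theory Defs
  imports
    "HOL-Analysis.Analysis"
    "HOL-Combinatorics.Cycles"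
    "HOL-Combinatorics.Orbits"
begin

text \<open>
  Interval maps are represented by total functions on the reals together with the end points of
  the interval; only the values on the interval matter.
\<close>

definition interval_map :: "(real \<Rightarrow> real) \<Rightarrow> real \<Rightarrow> real \<Rightarrow> bool" where
  "interval_map f a b \<longleftrightarrow> a < b \<and> continuous_on {a..b} f \<and> f ` {a..b} \<subseteq> {a..b}"

definition nonfixed_periodic :: "(real \<Rightarrow> real) \<Rightarrow> real \<Rightarrow> bool" where
  "nonfixed_periodic f y \<longleftrightarrow> (\<exists>n>0. (f ^^ n) y = y) \<and> f y \<noteq> y"

definition chi :: "(real \<Rightarrow> real) \<Rightarrow> real \<Rightarrow> real" where
  "chi f x = (if (f x - x) * (f (f x) - f x) \<le> 0 then 1/2 else 0)"

text \<open>\<^const>\<open>least_power\<close> is the minimal period of a periodic point.\<close>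

definition over_rotation_number :: "(real \<Rightarrow> real) \<Rightarrow> real \<Rightarrow> real" where
  "over_rotation_number f y =
     (\<Sum>i<least_power f y. chi f ((f ^^ i) y)) / real (least_power f y)"

definition over_rotation_interval :: "(real \<Rightarrow> real) \<Rightarrow> real \<Rightarrow> real \<Rightarrow> real set" where
  "over_rotation_interval f a b =
     closure {over_rotation_number f y | y. y \<in> {a..b} \<and> nonfixed_periodic f y}"

text \<open>The last condition is a standing assumption on the unimodal maps considered.\<close>

definition unimodal_map :: "(real \<Rightarrow> real) \<Rightarrow> bool" where
  "unimodal_map f \<longleftrightarrow> interval_map f 0 1 \<and>
     (\<exists>c. 0 < c \<and> c < 1 \<and> f c = 1 \<and> f 1 = 0 \<and>
          strict_mono_on {0..c} f \<and> strict_antimono_on {c..1} f \<and>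
          (\<forall>x\<in>{0..<c}. f x \<noteq> x))"

text \<open>
  A pattern of period \<open>n\<close> is a cyclic permutation of \<open>{1..n}\<close>, extended by the identity outside
  \<open>{1..n}\<close>. With this convention the function determines \<open>n\<close>, so that equality of patterns is
  equality of functions.
\<close>

definition pattern :: "nat \<Rightarrow> (nat \<Rightarrow> nat) \<Rightarrow> bool" where
  "pattern n \<pi> \<longleftrightarrow> \<pi> permutes {1..n} \<and> cyclic_on \<pi> {1..n}"

definition exhibits_on ::
    "(real \<Rightarrow> real) \<Rightarrow> real \<Rightarrow> real \<Rightarrow> real set \<Rightarrow> (nat \<Rightarrow> nat) \<Rightarrow> bool" where
  "exhibits_on f a b P \<pi> \<longleftrightarrow> P \<subseteq> {a..b} \<and>
     (\<exists>n h. pattern n \<pi> \<and> strict_mono_on {1..n} h \<and> h ` {1..n} = P \<and>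
            (\<forall>i\<in>{1..n}. f (h i) = h (\<pi> i)))"

definition exhibits :: "(real \<Rightarrow> real) \<Rightarrow> real \<Rightarrow> real \<Rightarrow> (nat \<Rightarrow> nat) \<Rightarrow> bool" where
  "exhibits f a b \<pi> \<longleftrightarrow> (\<exists>P. exhibits_on f a b P \<pi>)"

definition forces :: "(nat \<Rightarrow> nat) \<Rightarrow> (nat \<Rightarrow> nat) \<Rightarrow> bool" where
  "forces \<pi> \<theta> \<longleftrightarrow> (\<forall>f a b. interval_map f a b \<longrightarrow> exhibits f a b \<pi> \<longrightarrow> exhibits f a b \<theta>)"

text \<open>
  Meaningful for patterns of period at least 2 only: the number does not depend on the cycle
  exhibiting the pattern.
\<close>

definition pattern_over_rotation_number :: "(nat \<Rightarrow> nat) \<Rightarrow> real" where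
  "pattern_over_rotation_number \<pi> =
     (THE r. \<exists>f a b P y. interval_map f a b \<and> exhibits_on f a b P \<pi> \<and> y \<in> P \<and>
                         r = over_rotation_number f y)"

text \<open>
  The pattern of a fixed point has no over-rotation number and has to be excluded explicitly:
  the formula would assign to it the value 1/2.
\<close>

definition over_twist_pattern :: "(nat \<Rightarrow> nat) \<Rightarrow> bool" where
  "over_twist_pattern \<pi> \<longleftrightarrow> (\<exists>n\<ge>2. pattern n \<pi>) \<and>
     \<not> (\<exists>m \<theta>. m \<ge> 2 \<and> pattern m \<theta> \<and> \<theta> \<noteq> \<pi> \<and>
             pattern_over_rotation_number \<theta> = pattern_over_rotation_number \<pi> \<and>
             forces \<pi> \<theta>)"

definition unimodal_pattern :: "(nat \<Rightarrow> nat) \<Rightarrow> bool" where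
  "unimodal_pattern \<pi> \<longleftrightarrow> (\<exists>f. unimodal_map f \<and> exhibits f 0 1 \<pi>)"

text \<open>
  The permutation \<open>\<phi>\<close> of \<open>{0, 1/q, \<dots>, (q-1)/q}\<close> is given on numerators,
  \<open>\<phi> (j/q) = phi_num p q j / q\<close>; integers are used because \<open>q - 2p - 1\<close> may be \<open>-1\<close>.
  The increasing bijection onto \<open>{1..q}\<close> is \<open>j/q \<mapsto> j + 1\<close>.
\<close>

definition phi_num :: "int \<Rightarrow> int \<Rightarrow> int \<Rightarrow> int" where
  "phi_num p q j =
     (if j \<le> q - 2 * p - 1 then j + p
      else if j \<le> q - p - 1 then 2 * q - 2 * p - 1 - j
      else q - 1 - j)"

definition gamma_pattern :: "nat \<Rightarrow> nat \<Rightarrow> nat \<Rightarrow> nat" where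
  "gamma_pattern p q i =
     (if i \<in> {1..q} then nat (phi_num (int p) (int q) (int i - 1)) + 1 else i)"

end

theory Submission
  imports Defs
begin

text \<open>
  Let \<open>f\<close> be unimodal, with turning point \<open>c\<close> and fixed point \<open>a > c\<close>. Every point to the left of
  \<open>a\<close> moves to the right, and every point to the right of \<open>a\<close> is mapped to the left of \<open>a\<close>. So the
  over-rotation number of a cycle is the proportion of its points to the right of \<open>a\<close>, and the
  cycle is described by the return map \<open>F\<close> to the left of \<open>a\<close>: \<open>F y = f y\<close> if that is again to the
  left, \<open>F y = f (f y)\<close> otherwise. Put \<open>n = q - p\<close>. Reflecting the points to the right of \<open>a\<close> turns
  \<open>\<gamma>\<^sub>\<rho>\<close>, \<open>\<rho> = p/q\<close>, into the rotation by \<open>p\<close> of \<open>q\<close> points. Equivalently, \<open>F\<close> moves the \<open>n\<close> left points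
  \<open>x\<^sub>0 < \<dots> < x\<^sub>n\<^sub>-\<^sub>1\<close> of a cycle of this pattern by \<open>j \<mapsto> j + p\<close> modulo \<open>n\<close>, and the steps that wrap
  around are those that visit the right side. Such points \<open>x\<close> are called a gamma orbit.
  
  The heart of the proof is the alternative \<open>gamma_orbit_or_gap\<close> for \<open>p < n\<close>: either there is a gamma
  orbit, or the frequency of right visits on every cycle exceeds \<open>p/n\<close> by a fixed positive amount.
  A gamma orbit is sought backwards: \<open>x\<^sub>j\<close> is the last point of the proper branch from which
  \<open>F\<close> reaches \<open>x\<^sub>j\<^sub>+\<^sub>p + d\<close>, for a small \<open>d > 0\<close>. These last exits depend monotonically on the target,
  so there is a greatest solution \<open>x\<close>. If for all \<open>d\<close> every last exit exists, the solutions decrease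
  to a gamma orbit as \<open>d\<close> tends to 0. If for some \<open>d\<close> one does not exist, then \<open>x\<^sub>0\<close> is the left end point
  of the interval, and every step of \<open>F\<close> along a cycle advances the position
  relative to \<open>x\<close> by at least \<open>p\<close>, wrapping around included. A cycle with too few right visits would
  advance by exactly \<open>p\<close> during a long time, and \<open>n\<close> consecutive points of it would form a subsolution that
  contradicts the choice of \<open>x\<close>.
  
  The amount being fixed matters because the over-rotation interval is a closure: a unimodal map whose
  cycles have over-rotation numbers with infimum at most \<open>\<rho>\<close> has a cycle of pattern \<open>\<gamma>\<^sub>\<rho>\<close>, even if
  the infimum equals \<open>\<rho>\<close>. In particular the over-rotation numbers of cycles form an up-set of the
  rationals up to \<open>1/2\<close>, which gives the second half of the theorem.
  
  Last exits exist for every continuous map. So the alternative also applies to an arbitrary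
  interval map that exhibits a unimodal pattern \<open>\<pi>\<close>, between the end points of the cycle; if \<open>\<pi>\<close> has
  over-rotation number \<open>\<rho>\<close> this cycle rules out the second case, and \<open>\<pi>\<close> forces \<open>\<gamma>\<^sub>\<rho>\<close>. Hence \<open>\<gamma>\<^sub>\<rho>\<close> is the
  only candidate. It is an over-twist pattern because there is a map in which it is the
  only pattern of over-rotation number \<open>\<rho>\<close>: a unimodal map cut off at the height of a gamma orbit.
  There, positions relative to the gamma orbit advance by at least \<open>p\<close>, so on a cycle with the same over-rotation
  number they advance by exactly \<open>p\<close>, and the largest points in each position form a gamma orbit that exhausts
  the cycle.
  
  For \<open>\<rho> = 1/2\<close> the pattern is the transposition; a point of period 2 comes from the intermediate value
  theorem for \<open>f \<circ> f\<close>, and \<open>t \<mapsto> 1 - t\<close> has no cycles of period above 2.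
\<close>

section \<open>Rotations, and drift along a cycle\<close>

lemma coprime_diff_right:
  fixes p q :: nat
  assumes "coprime p q" "p \<le> q"
  shows "coprime p (q - p)"
proof -
  obtain n where "q = n + p" using assms(2) by (metis le_add_diff_inverse2)
  then show ?thesis using assms(1) by (simp add: coprime_iff_gcd_eq_1 add.commute[of n p])
qed

lemma coprime_multiples_inj:
  fixes p n s :: nat
  assumes "coprime p n"
  shows "inj_on (\<lambda>i. (s + i * p) mod n) {..<n}"
proof (rule linorder_inj_onI)
  fix i j assume ij: "i < j" "i \<in> {..<n}" "j \<in> {..<n}"
  show "(s + i * p) mod n \<noteq> (s + j * p) mod n"
  proof
    assume "(s + i * p) mod n = (s + j * p) mod n"
    then have "n dvd (s + j * p) - (s + i * p)"
      by (metis mod_eq_dvd_iff_nat add_le_cancel_left less_imp_le_nat ij(1) mult_le_mono1)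
    moreover have "(s + j * p) - (s + i * p) = (j - i) * p"
      by (simp add: diff_mult_distrib)
    ultimately have "n dvd j - i"
      using assms by (metis coprime_commute coprime_dvd_mult_left_iff)
    with ij show False by (simp add: nat_dvd_not_less)
  qed
qed (auto)

lemma coprime_multiples_bij:
  fixes p n s :: nat
  assumes "coprime p n" "0 < n"
  shows "bij_betw (\<lambda>i. (s + i * p) mod n) {..<n} {..<n}"
proof -
  have "(\<lambda>i. (s + i * p) mod n) ` {..<n} \<subseteq> {..<n}" using assms by auto
  then show ?thesis
    using coprime_multiples_inj[OF assms(1), of s]
    by (simp add: bij_betw_def card_image card_subset_eq)
qed

lemma rotation_invariant_all:
  fixes p n :: nat
  assumes "coprime p n" "0 < n" "s \<in> E" "s < n"
    and step: "\<And>j. j \<in> E \<Longrightarrow> j < n \<Longrightarrow> (j + p) mod n \<in> E"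
    and "j < n"
  shows "j \<in> E"
proof -
  have *: "(s + i * p) mod n \<in> E" for i
  proof (induction i)
    case (Suc i)
    have "((s + i * p) mod n + p) mod n \<in> E" using step[OF Suc] assms(2) by simp
    then show ?case by (simp add: mod_simps ac_simps)
  qed (use assms in auto)
  have "j \<in> (\<lambda>i. (s + i * p) mod n) ` {..<n}"
    using coprime_multiples_bij[OF assms(1,2), of s] assms(6) by (simp add: bij_betw_def)
  with * show ?thesis by auto
qed

text \<open>
  Below, \<open>S\<close> is the left part of a cycle, \<open>R\<close> the return map, \<open>w y\<close> is 1 if the step from \<open>y\<close> visits the
  right side, and \<open>pos\<close> is a position in \<open>{0..<n}\<close>; \<open>n * w y\<close> accounts for wrapping around. The positions
  cancel in the sum because \<open>R\<close> permutes \<open>S\<close>.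
\<close>
lemma drift_total:
  fixes pos w :: "'a \<Rightarrow> nat" and n p :: nat
  assumes R: "bij_betw R S S"
  shows "(\<Sum>y\<in>S. int (pos (R y)) + int n * int (w y) - int (pos y) - int p)
          = int n * int (\<Sum>y\<in>S. w y) - int p * int (card S)"
proof -
  have "(\<Sum>y\<in>S. int (pos (R y))) = (\<Sum>y\<in>S. int (pos y))"
    using sum.reindex_bij_betw[OF R, of "\<lambda>y. int (pos y)"] .
  then show ?thesis
    by (simp add: sum.distrib sum_subtractf sum_distrib_left mult.commute)
qed

lemma bij_betw_funpow:
  assumes "bij_betw R S S"
  shows "bij_betw (R ^^ i) S S"
  using assms by (induction i) (auto intro: bij_betw_trans)

lemma drift_tight:
  fixes pos w :: "'a \<Rightarrow> nat" and n p :: nat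
  assumes fin: "finite S" and R: "bij_betw R S S"
    and le: "\<And>y. y \<in> S \<Longrightarrow> pos y + p \<le> pos (R y) + n * w y"
    and total: "n * (\<Sum>y\<in>S. w y) = p * card S" and y: "y \<in> S"
  shows "pos (R y) + n * w y = pos y + p"
proof -
  let ?e = "\<lambda>y. int (pos (R y)) + int n * int (w y) - int (pos y) - int p"
  have nonneg: "?e y \<ge> 0" if "y \<in> S" for y
  proof -
    have "int (pos y + p) \<le> int (pos (R y) + n * w y)"
      using le[OF that] by (simp only: of_nat_le_iff)
    then show ?thesis by simp
  qed
  have "(\<Sum>y\<in>S. ?e y) = int (n * (\<Sum>y\<in>S. w y)) - int (p * card S)"
    unfolding drift_total[OF R] by simp
  then have "(\<Sum>y\<in>S. ?e y) = 0" using total by simp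
  then have "?e y = 0" using nonneg fin y by (simp add: sum_nonneg_eq_0_iff)
  then have "int (pos (R y) + n * w y) = int (pos y + p)" by simp
  then show ?thesis by (simp only: of_nat_eq_iff)
qed

text \<open>
  If every step gains at least \<open>p\<close> and the total surplus over a period is less than \<open>card S / L\<close>, then
  averaging over the starting point, with integrality, finds \<open>L\<close> consecutive steps with no surplus at all.
\<close>
lemma drift_window:
  fixes pos w :: "'a \<Rightarrow> nat" and n p L :: nat
  assumes fin: "finite S" and R: "bij_betw R S S"
    and le: "\<And>y. y \<in> S \<Longrightarrow> pos y + p \<le> pos (R y) + n * w y"
    and small: "int L * (int n * int (\<Sum>y\<in>S. w y) - int p * int (card S)) < int (card S)"
  obtains y where "y \<in> S"
    and "\<And>i. i < L \<Longrightarrow> pos (R ((R ^^ i) y)) + n * w ((R ^^ i) y) = pos ((R ^^ i) y) + p"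
proof -
  let ?e = "\<lambda>y. int (pos (R y)) + int n * int (w y) - int (pos y) - int p"
  have nonneg: "?e y \<ge> 0" if "y \<in> S" for y
  proof -
    have "int (pos y + p) \<le> int (pos (R y) + n * w y)"
      using le[OF that] by (simp only: of_nat_le_iff)
    then show ?thesis by simp
  qed
  have mem: "(R ^^ i) y \<in> S" if "y \<in> S" for y i
    using bij_betw_funpow[OF R, of i] that by (auto simp: bij_betw_def)
  have "(\<Sum>y\<in>S. \<Sum>i<L. ?e ((R ^^ i) y)) = (\<Sum>i<L. \<Sum>y\<in>S. ?e ((R ^^ i) y))"
    by (rule sum.swap)
  also have "\<dots> = (\<Sum>i<L. \<Sum>y\<in>S. ?e y)"
    by (intro sum.cong refl sum.reindex_bij_betw[OF bij_betw_funpow[OF R]])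
  also have "\<dots> = int L * (int n * int (\<Sum>y\<in>S. w y) - int p * int (card S))"
    by (subst drift_total[OF R]) simp
  finally have lt: "(\<Sum>y\<in>S. \<Sum>i<L. ?e ((R ^^ i) y)) < (\<Sum>y\<in>S. 1)" using small by simp
  obtain y where y: "y \<in> S" "(\<Sum>i<L. ?e ((R ^^ i) y)) < 1"
  proof (rule ccontr)
    assume "\<not> thesis"
    then have "(\<Sum>y\<in>S. 1) \<le> (\<Sum>y\<in>S. \<Sum>i<L. ?e ((R ^^ i) y))"
      using that by (intro sum_mono) (meson not_less)
    with lt show False by simp
  qed
  have "(\<Sum>i<L. ?e ((R ^^ i) y)) = 0"
    using y(2) sum_nonneg[of "{..<L}" "\<lambda>i. ?e ((R ^^ i) y)"] nonneg[OF mem[OF y(1)]] by fastforce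
  then have *: "?e ((R ^^ i) y) = 0" if "i < L" for i
    using that nonneg[OF mem[OF y(1)]] by (simp add: sum_nonneg_eq_0_iff)
  have "pos (R ((R ^^ i) y)) + n * w ((R ^^ i) y) = pos ((R ^^ i) y) + p" if "i < L" for i
  proof -
    have "int (pos (R ((R ^^ i) y)) + n * w ((R ^^ i) y)) = int (pos ((R ^^ i) y) + p)"
      using * [OF that] by simp
    then show ?thesis by (simp only: of_nat_eq_iff)
  qed
  with y(1) show ?thesis by (rule that)
qed

definition position :: "(nat \<Rightarrow> real) \<Rightarrow> nat \<Rightarrow> real \<Rightarrow> nat" where
  "position x n y = Max {j. j < n \<and> x j \<le> y}"

lemma position:
  assumes "0 < n" "x 0 \<le> y"
  shows "position x n y < n" "x (position x n y) \<le> y"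
proof -
  have "position x n y \<in> {j. j < n \<and> x j \<le> y}"
    unfolding position_def using assms by (intro Max_in) auto
  then show "position x n y < n" "x (position x n y) \<le> y" by auto
qed

lemma position_ge:
  assumes "j < n" "x j \<le> y"
  shows "j \<le> position x n y"
  unfolding position_def using assms by (intro Max_ge) auto

lemma position_less_imp_less:
  assumes "0 < n" "x 0 \<le> y" "j < n" "position x n y < j" shows "y < x j"
  using position_ge[of j n x y] assms by force

lemma position_less_less:
  assumes "0 < n" "x 0 \<le> y" "x 0 \<le> z" "position x n y < position x n z" shows "y < z"
proof -
  note z = position[OF assms(1), of x z, OF assms(3)]
  have "y < x (position x n z)"
    using position_less_imp_less[of n x y "position x n z"] assms z by blast
  then show ?thesis using z by linarith
qed

section \<open>Cycles and the return map to the left of a fixed point\<close>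

text \<open>
  An invariant finite set on which only the points to the left of \<open>a\<close> move up, and on
  which the right side is left at once. It need not be a single cycle.
\<close>
definition sided_cycle :: "(real \<Rightarrow> real) \<Rightarrow> real \<Rightarrow> real set \<Rightarrow> bool" where
  "sided_cycle g a Q \<longleftrightarrow> finite Q \<and> bij_betw g Q Q \<and>
     (\<forall>y\<in>Q. (y < a \<and> y < g y) \<or> (a < y \<and> g y < a))"

definition left_return :: "(real \<Rightarrow> real) \<Rightarrow> real \<Rightarrow> real \<Rightarrow> real" where
  "left_return g a y = (if a < g y then g (g y) else g y)"

abbreviation "left_part a Q \<equiv> {y\<in>Q. y < (a::real)}"
abbreviation "right_part a Q \<equiv> {y\<in>Q. (a::real) < y}"

lemma sided_cycleD:
  assumes "sided_cycle g a Q"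
  shows "finite Q" "bij_betw g Q Q" "inj_on g Q"
    "\<And>y. y \<in> Q \<Longrightarrow> g y \<in> Q" "\<And>y. y \<in> Q \<Longrightarrow> y \<noteq> a"
    "\<And>y. y \<in> Q \<Longrightarrow> y < a \<Longrightarrow> y < g y"
    "\<And>y. y \<in> Q \<Longrightarrow> a < y \<Longrightarrow> g y < a"
  using assms by (force simp: sided_cycle_def bij_betw_def)+

lemma left_return_in:
  assumes "sided_cycle g a Q" "y \<in> left_part a Q"
  shows "left_return g a y \<in> left_part a Q"
proof (cases "a < g y")
  case True
  then show ?thesis using sided_cycleD(4,7)[OF assms(1)] assms(2) by (auto simp: left_return_def)
next
  case False
  have "g y \<in> Q" using sided_cycleD(4)[OF assms(1)] assms(2) by auto
  then have "g y \<noteq> a" using sided_cycleD(5)[OF assms(1)] by blast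
  then show ?thesis using False \<open>g y \<in> Q\<close> by (auto simp: left_return_def)
qed

lemma left_return_bij:
  assumes Q: "sided_cycle g a Q"
  shows "bij_betw (left_return g a) (left_part a Q) (left_part a Q)"
proof -
  have fin: "finite (left_part a Q)" using sided_cycleD(1)[OF Q] by simp
  have sub: "left_return g a ` left_part a Q \<subseteq> left_part a Q"
    using left_return_in[OF Q] by (simp add: image_subset_iff)
  have inj: "inj_on (left_return g a) (left_part a Q)"
  proof (rule inj_onI)
    fix y z assume y: "y \<in> left_part a Q" and z: "z \<in> left_part a Q"
      and eq: "left_return g a y = left_return g a z"
    have mem: "y \<in> Q" "z \<in> Q" "g y \<in> Q" "g z \<in> Q" "y < a" "z < a"
      using y z sided_cycleD(4)[OF Q] by auto
    note inj = inj_onD[OF sided_cycleD(3)[OF Q]]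
    show "y = z"
    proof (cases "a < g y"; cases "a < g z")
      assume "a < g y" "\<not> a < g z"
      then have "g y = z" using eq mem inj by (auto simp: left_return_def)
      with \<open>a < g y\<close> mem show ?thesis by simp
    next
      assume "\<not> a < g y" "a < g z"
      then have "g z = y" using eq mem inj by (auto simp: left_return_def)
      with \<open>a < g z\<close> mem show ?thesis by simp
    qed (use eq mem inj in \<open>auto simp: left_return_def\<close>)
  qed
  show ?thesis
    using inj sub fin by (simp add: bij_betw_def card_image card_subset_eq)
qed

text \<open>
  The points to the right of \<open>a\<close> are entered from the left, each of them once.
\<close>
lemma sided_cycle_crossings:
  assumes Q: "sided_cycle g a Q"
  shows "card {y\<in>Q. y < a \<and> a < g y} = card (right_part a Q)"
proof -
  have "g ` {y\<in>Q. y < a \<and> a < g y} = right_part a Q"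
  proof (intro equalityI subsetI)
    fix r assume r: "r \<in> right_part a Q"
    have "g ` Q = Q" using sided_cycleD(2)[OF Q] by (rule bij_betw_imp_surj_on)
    then have "r \<in> g ` Q" using r by simp
    then obtain y where y: "y \<in> Q" "g y = r" by blast
    have "\<not> a < y" using sided_cycleD(7)[OF Q y(1)] y(2) r by auto
    then have "y < a" using sided_cycleD(5)[OF Q y(1)] by simp
    then show "r \<in> g ` {y\<in>Q. y < a \<and> a < g y}" using y r by auto
  next
    fix r assume "r \<in> g ` {y\<in>Q. y < a \<and> a < g y}"
    then show "r \<in> right_part a Q" using sided_cycleD(4)[OF Q] by blast
  qed
  moreover have "inj_on g {y\<in>Q. y < a \<and> a < g y}"
    using sided_cycleD(3)[OF Q] by (rule inj_on_subset) auto
  ultimately show ?thesis using card_image[of g "{y\<in>Q. y < a \<and> a < g y}"] by simp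
qed

lemma sided_cycle_crossing_sum:
  assumes Q: "sided_cycle g a Q"
  shows "(\<Sum>y\<in>left_part a Q. if a < g y then 1 else 0) = card (right_part a Q)"
proof -
  have "{y \<in> left_part a Q. a < g y} = {y\<in>Q. y < a \<and> a < g y}" by auto
  then show ?thesis
    using sided_cycleD(1)[OF Q] sided_cycle_crossings[OF Q]
    by (simp flip: sum.inter_filter)
qed

lemma sided_cycle_card:
  assumes Q: "sided_cycle g a Q"
  shows "card Q = card (left_part a Q) + card (right_part a Q)"
    "card (right_part a Q) \<le> card (left_part a Q)"
proof -
  have Un: "Q = left_part a Q \<union> right_part a Q" using sided_cycleD(5)[OF Q] by force
  show "card Q = card (left_part a Q) + card (right_part a Q)"
  proof -
    have "card (left_part a Q \<union> right_part a Q) = card (left_part a Q) + card (right_part a Q)"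
      using sided_cycleD(1)[OF Q] by (intro card_Un_disjoint) auto
    then show ?thesis by (simp only: Un[symmetric])
  qed
  show "card (right_part a Q) \<le> card (left_part a Q)"
    unfolding sided_cycle_crossings[OF Q, symmetric]
    using sided_cycleD(1)[OF Q] by (intro card_mono) auto
qed

lemma sided_cycle_parts_nonempty:
  assumes Q: "sided_cycle g a Q" and "Q \<noteq> {}"
  shows "left_part a Q \<noteq> {}" "right_part a Q \<noteq> {}"
proof -
  show left: "left_part a Q \<noteq> {}"
  proof
    assume "left_part a Q = {}"
    then have "card (left_part a Q) = 0" by (simp only: card.empty)
    then have "card Q = 0" using sided_cycle_card[OF Q] by linarith
    then show False using sided_cycleD(1)[OF Q] assms(2) by simp
  qed
  have fin: "finite (left_part a Q)" using sided_cycleD(1)[OF Q] by simp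
  \<comment> \<open>The largest left point moves up and can only land on the right.\<close>
  define y where "y = Max (left_part a Q)"
  have y: "y \<in> left_part a Q" unfolding y_def using fin left by (rule Max_in)
  have "g y \<notin> left_part a Q"
    using y Max_ge[OF fin, of "g y"] sided_cycleD(6)[OF Q, of y] unfolding y_def[symmetric] by auto
  moreover have gy: "g y \<in> Q" using y sided_cycleD(4)[OF Q] by blast
  ultimately have "a < g y" using sided_cycleD(5)[OF Q gy] by auto
  then show "right_part a Q \<noteq> {}" using y sided_cycleD(4)[OF Q, of y] by auto
qed

text \<open>
  The direction of motion changes exactly on entering and on leaving the right side, so each point to the
  right of \<open>a\<close> accounts for two halves. Hence over-rotation numbers are frequencies of visits to the right.
\<close>
lemma sided_cycle_chi_sum:
  assumes Q: "sided_cycle g a Q"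
  shows "(\<Sum>y\<in>Q. chi g y) = real (card (right_part a Q))"
proof -
  have chi: "chi g y = (if y < a \<and> a < g y then 1/2 else 0) + (if a < y then 1/2 else 0)"
    if "y \<in> Q" for y
  proof -
    have gy: "g y \<in> Q" using sided_cycleD(4)[OF Q that] .
    have up: "y < a \<Longrightarrow> y < g y" and down: "a < y \<Longrightarrow> g y < a" and ne: "y \<noteq> a"
      using sided_cycleD(5-7)[OF Q] that by blast+
    have up': "g y < a \<Longrightarrow> g y < g (g y)" and down': "a < g y \<Longrightarrow> g (g y) < a" and ne': "g y \<noteq> a"
      using sided_cycleD(5-7)[OF Q] gy by blast+
    consider "y < a" "g y < a" | "y < a" "a < g y" | "a < y" using ne ne' by fastforce
    then show ?thesis
    proof cases
      case 1
      then have "0 < (g y - y) * (g (g y) - g y)" using up up' by (intro mult_pos_pos) auto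
      then show ?thesis using 1 by (simp add: chi_def)
    next
      case 2
      then have "(g y - y) * (g (g y) - g y) \<le> 0" using down' by (intro mult_nonneg_nonpos) auto
      then show ?thesis using 2 by (simp add: chi_def)
    next
      case 3
      then have "g y < a" using down by blast
      then have "(g y - y) * (g (g y) - g y) \<le> 0" using 3 up' by (intro mult_nonpos_nonneg) auto
      then show ?thesis using 3 by (simp add: chi_def)
    qed
  qed
  have "(\<Sum>y\<in>Q. chi g y)
      = (\<Sum>y\<in>Q. if y < a \<and> a < g y then 1/2 else 0) + (\<Sum>y\<in>Q. if a < y then 1/2 else 0)"
    by (simp add: chi sum.distrib)
  also have "\<dots> = 1/2 * real (card {y\<in>Q. y < a \<and> a < g y}) + 1/2 * real (card (right_part a Q))"
    using sided_cycleD(1)[OF Q] by (simp flip: sum.inter_filter)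
  finally show ?thesis by (simp add: sided_cycle_crossings[OF Q])
qed

section \<open>Pulling monotone vectors back along last exits\<close>

text \<open>
  Beyond the last point \<open>s\<close> where \<open>f\<close> is at most \<open>v\<close>, the values of \<open>f\<close> stay above \<open>v\<close>. So \<open>s\<close> is a point
  of the fibre over \<open>v\<close> that is monotone in \<open>v\<close>, for any continuous \<open>f\<close>: it replaces the inverse of a monotone
  branch.
\<close>
lemma last_exit:
  fixes f :: "real \<Rightarrow> real"
  assumes cont: "continuous_on {l..u} f" and x0: "x0 \<in> {l..u}" "f x0 \<le> v" and v: "v \<le> f u"
  defines "s \<equiv> Sup {y\<in>{l..u}. f y \<le> v}"
  shows "s \<in> {l..u}" "f s = v"
    "\<And>y. y \<in> {l..u} \<Longrightarrow> s \<le> y \<Longrightarrow> v \<le> f y" "\<And>y. y \<in> {l..u} \<Longrightarrow> f y \<le> v \<Longrightarrow> y \<le> s"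
proof -
  let ?S = "{y\<in>{l..u}. f y \<le> v}"
  have "closed ?S"
    using continuous_closed_preimage[OF cont closed_atLeastAtMost, of "{..v}"]
    by (simp add: vimage_def Int_def)
  then have "compact ?S"
    using compact_Int_closed[of "{l..u}" ?S] by (simp add: Int_def conj_ac)
  moreover have "?S \<noteq> {}" using x0 by auto
  ultimately obtain t where t: "t \<in> ?S" "\<And>y. y \<in> ?S \<Longrightarrow> y \<le> t"
    using compact_attains_sup[of ?S] by blast
  have s: "s = t" unfolding s_def using t by (intro cSup_eq_maximum) auto
  show mem: "s \<in> {l..u}" using t(1) s by auto
  show up: "y \<le> s" if "y \<in> {l..u}" "f y \<le> v" for y using t(2) that s by auto
  have "\<exists>y\<ge>s. y \<le> u \<and> f y = v"
    using t(1) s v mem by (intro IVT') (auto intro: continuous_on_subset[OF cont])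
  then obtain y where y: "s \<le> y" "y \<le> u" "f y = v" by blast
  with up[of y] mem have "y = s" by auto
  with y show eq: "f s = v" by simp
  show "v \<le> f y" if "y \<in> {l..u}" "s \<le> y" for y
    using up[OF that(1)] that(2) eq by (cases "y = s") force+
qed

definition monotone_vectors :: "nat \<Rightarrow> real \<Rightarrow> real \<Rightarrow> (nat \<Rightarrow> real) set" where
  "monotone_vectors n A a =
     {y. (\<forall>j<n. A \<le> y j \<and> y j \<le> a) \<and> (\<forall>i j. i \<le> j \<longrightarrow> j < n \<longrightarrow> y i \<le> y j)}"

text \<open>
  The Knaster-Tarski theorem for the lattice of increasing vectors in a compact interval. That the solution is
  also the greatest subsolution is what contradicts the existence of slow cycles later on.
\<close>
lemma greatest_monotone_fixpoint:
  fixes T :: "(nat \<Rightarrow> real) \<Rightarrow> nat \<Rightarrow> real" and n :: nat and A a :: real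
  defines "V \<equiv> monotone_vectors n A a"
  assumes "A \<le> a"
    and maps: "\<And>y. y \<in> V \<Longrightarrow> T y \<in> V"
    and mono: "\<And>y z j. \<lbrakk>y \<in> V; z \<in> V; \<And>i. i < n \<Longrightarrow> y i \<le> z i; j < n\<rbrakk> \<Longrightarrow> T y j \<le> T z j"
  obtains x where "x \<in> V" "\<And>j. j < n \<Longrightarrow> x j = T x j"
    "\<And>y j. \<lbrakk>y \<in> V; \<And>i. i < n \<Longrightarrow> y i \<le> T y i; j < n\<rbrakk> \<Longrightarrow> y j \<le> x j"
proof -
  define Y where "Y = {y\<in>V. \<forall>j<n. y j \<le> T y j}"
  define x where "x j = (SUP y\<in>Y. y j)" for j
  have "(\<lambda>_. A) \<in> V" using \<open>A \<le> a\<close> by (auto simp: V_def monotone_vectors_def)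
  moreover from maps[OF this] have "\<forall>j<n. A \<le> T (\<lambda>_. A) j"
    by (auto simp: V_def monotone_vectors_def)
  ultimately have ne: "(\<lambda>_. A) \<in> Y" by (auto simp: Y_def)
  have bd: "bdd_above ((\<lambda>y. y j) ` Y)" if "j < n" for j
    using that by (intro bdd_aboveI[of _ a]) (auto simp: Y_def V_def monotone_vectors_def)
  have upper: "y j \<le> x j" if "y \<in> Y" "j < n" for y j
    unfolding x_def using bd[OF that(2)] that(1) by (rule cSUP_upper2) simp
  have least: "x j \<le> b" if "\<And>y. y \<in> Y \<Longrightarrow> y j \<le> b" for j b
    unfolding x_def using ne that by (intro cSUP_least) auto
  have xV: "x \<in> V"
    unfolding V_def monotone_vectors_def
  proof (intro CollectI conjI allI impI)
    fix j assume "j < n"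
    show "A \<le> x j" using upper[OF ne \<open>j < n\<close>] .
    show "x j \<le> a"
      by (rule least) (use \<open>j < n\<close> in \<open>auto simp: Y_def V_def monotone_vectors_def\<close>)
  next
    fix i j :: nat assume ij: "i \<le> j" "j < n"
    show "x i \<le> x j"
    proof (rule least)
      fix y assume y: "y \<in> Y"
      then have "y i \<le> y j" using ij by (auto simp: Y_def V_def monotone_vectors_def)
      then show "y i \<le> x j" using upper[OF y ij(2)] by linarith
    qed
  qed
  have le: "x j \<le> T x j" if "j < n" for j
  proof (rule least)
    fix y assume y: "y \<in> Y"
    then have "y j \<le> T y j" using that by (auto simp: Y_def)
    also have "\<dots> \<le> T x j" using mono[of y x j] y xV upper that by (auto simp: Y_def)
    finally show "y j \<le> T x j" .
  qed
  have TxY: "T x \<in> Y"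
    unfolding Y_def using maps[OF xV] mono[OF xV maps[OF xV] le] by auto
  show ?thesis
  proof (rule that[OF xV])
    show "x j = T x j" if "j < n" for j using le[OF that] upper[OF TxY that] by linarith
    show "y j \<le> x j" if "y \<in> V" "\<And>i. i < n \<Longrightarrow> y i \<le> T y i" "j < n" for y j
      using upper[of y j] that by (auto simp: Y_def)
  qed
qed

text \<open>
  What is used of a unimodal map, and what remains of it in an arbitrary map with a cycle of unimodal
  pattern: the orbit \<open>c \<mapsto> B \<mapsto> A\<close> of the turning point and a fixed point between \<open>c\<close> and \<open>B\<close>. The
  map may leave \<open>{A..B}\<close>.
\<close>
locale folded =
  fixes g :: "real \<Rightarrow> real" and A c a B :: real
  assumes A_le_c: "A \<le> c" and c_less_a: "c < a" and a_less_B: "a < B"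
    and cont: "continuous_on {A..B} g"
    and g_c: "g c = B" and g_B: "g B = A" and g_a: "g a = a"
begin

text \<open>
  The three last exits: \<open>lam\<close> inverts \<open>g\<close> on \<open>{A..c}\<close>, with the default \<open>A\<close> if the target is too low to be
  attained there; \<open>kap\<close> inverts it on \<open>{c..a}\<close>. On \<open>{a..B}\<close>, which the
  reflection about \<open>a\<close> reverses, the last exit is the first point \<open>rho v\<close> with value at most \<open>v\<close>; it is written as the
  supremum of a mirror image. The second branch of the return map is inverted by \<open>kap \<circ> rho\<close>.
\<close>
definition lam :: "real \<Rightarrow> real" where
  "lam v = (if \<exists>y\<in>{A..c}. g y \<le> v then Sup {y\<in>{A..c}. g y \<le> v} else A)"

definition kap :: "real \<Rightarrow> real" where
  "kap w = Sup {y\<in>{c..a}. w \<le> g y}"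

definition rho :: "real \<Rightarrow> real" where
  "rho v = - Sup {y\<in>{-B..-a}. g (- y) \<le> v}"

lemma lam:
  assumes "v \<le> a"
  shows "lam v \<in> {A..c}" "\<And>y. y \<in> {A..c} \<Longrightarrow> lam v \<le> y \<Longrightarrow> v \<le> g y"
    "\<And>y. y \<in> {A..c} \<Longrightarrow> g y \<le> v \<Longrightarrow> y \<le> lam v"
    "\<And>y. y \<in> {A..c} \<Longrightarrow> g y \<le> v \<Longrightarrow> g (lam v) = v"
proof -
  have c: "continuous_on {A..c} g"
    by (rule continuous_on_subset[OF cont]) (use c_less_a a_less_B in auto)
  have v: "v \<le> g c" using assms g_c a_less_B by simp
  note * = last_exit[OF c _ _ v]
  show "lam v \<in> {A..c}" unfolding lam_def using *(1) A_le_c by auto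
  show "v \<le> g y" if "y \<in> {A..c}" "lam v \<le> y" for y
    using that *(3)[OF _ _ that(1)] unfolding lam_def
    by (cases "\<exists>y\<in>{A..c}. g y \<le> v") (auto simp: not_le intro: less_imp_le)
  show "y \<le> lam v" "g (lam v) = v" if "y \<in> {A..c}" "g y \<le> v" for y
    using *(2)[OF that] *(4)[OF that that] that unfolding lam_def by auto
qed

lemma kap:
  assumes "w \<in> {a..B}"
  shows "kap w \<in> {c..a}" "g (kap w) = w" "\<And>y. y \<in> {c..a} \<Longrightarrow> kap w \<le> y \<Longrightarrow> g y \<le> w"
    "\<And>y. y \<in> {c..a} \<Longrightarrow> w \<le> g y \<Longrightarrow> y \<le> kap w"
proof -
  have c: "continuous_on {c..a} (\<lambda>x. - g x)"
    by (intro continuous_intros continuous_on_subset[OF cont]) (use A_le_c a_less_B in auto)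
  have 1: "c \<in> {c..a}" "- g c \<le> - w" "- w \<le> - g a" using assms c_less_a g_c g_a by auto
  have eq: "kap w = Sup {y\<in>{c..a}. - g y \<le> - w}" by (simp add: kap_def)
  note * = last_exit[OF c 1, folded eq]
  show "kap w \<in> {c..a}" "g (kap w) = w" "\<And>y. y \<in> {c..a} \<Longrightarrow> kap w \<le> y \<Longrightarrow> g y \<le> w"
    "\<And>y. y \<in> {c..a} \<Longrightarrow> w \<le> g y \<Longrightarrow> y \<le> kap w"
    using *(1,2) *(3)[of] *(4)[of] by auto
qed

lemma rho:
  assumes "v \<in> {A..a}"
  shows "rho v \<in> {a..B}" "g (rho v) = v" "\<And>y. y \<in> {a..B} \<Longrightarrow> y \<le> rho v \<Longrightarrow> v \<le> g y"
    "\<And>y. y \<in> {a..B} \<Longrightarrow> g y \<le> v \<Longrightarrow> rho v \<le> y"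
proof -
  have c: "continuous_on {-B..-a} (\<lambda>x. g (- x))"
    by (intro continuous_on_compose2[OF cont] continuous_intros) (use A_le_c c_less_a in auto)
  have 1: "- B \<in> {-B..-a}" "g (- (- B)) \<le> v" "v \<le> g (- (- a))"
    using assms a_less_B g_B g_a by auto
  note * = last_exit[OF c 1]
  show "rho v \<in> {a..B}" "g (rho v) = v" using *(1,2) by (auto simp: rho_def)
  show "v \<le> g y" if "y \<in> {a..B}" "y \<le> rho v" for y
    using *(3)[of "- y"] that by (auto simp: rho_def)
  show "rho v \<le> y" if "y \<in> {a..B}" "g y \<le> v" for y
    using *(4)[of "- y"] that by (auto simp: rho_def)
qed

lemma lam_mono:
  assumes "v \<le> v'" "v' \<le> a" shows "lam v \<le> lam v'"
proof (cases "\<exists>y\<in>{A..c}. g y \<le> v")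
  case True
  then have "g (lam v) = v" using lam(4)[of v] assms by auto
  then show ?thesis using lam(3)[of v' "lam v"] lam(1)[of v] assms by auto
next
  case False
  then have "lam v = A" by (simp add: lam_def)
  then show ?thesis using lam(1)[of v'] assms by simp
qed

lemma kap_antimono:
  assumes "w \<in> {a..B}" "w' \<in> {a..B}" "w \<le> w'" shows "kap w' \<le> kap w"
  using kap(4)[OF assms(1), of "kap w'"] kap(1,2)[OF assms(2)] assms(3) by simp

lemma rho_antimono:
  assumes "v \<in> {A..a}" "v' \<in> {A..a}" "v \<le> v'" shows "rho v' \<le> rho v"
  using rho(4)[OF assms(2), of "rho v"] rho(1,2)[OF assms(1)] assms(3) by simp

text \<open>
  One step backwards along the rotation by \<open>p\<close>, towards targets raised by \<open>d\<close>. The cap at \<open>a\<close> keeps the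
  targets in the domain of the inverse branches.
\<close>
definition pullback :: "nat \<Rightarrow> nat \<Rightarrow> real \<Rightarrow> (nat \<Rightarrow> real) \<Rightarrow> nat \<Rightarrow> real" where
  "pullback n p d y j =
     (if j < n - p then lam (min (y (j + p) + d) a)
      else kap (rho (min (y (j + p - n) + d) a)))"

lemma pullback_arg:
  assumes "y \<in> monotone_vectors n A a" "j < n" "0 \<le> d"
  shows "min (y j + d) a \<in> {A..a}"
  using assms A_le_c c_less_a by (auto simp: monotone_vectors_def min_def intro: order_trans)

lemma pullback_mono:
  assumes y: "y \<in> monotone_vectors n A a" "z \<in> monotone_vectors n A a" and d: "0 \<le> d" "d \<le> e"
    and le: "\<And>i. i < n \<Longrightarrow> y i \<le> z i" and "j < n" "0 < p" "p < n"
  shows "pullback n p d y j \<le> pullback n p e z j"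
proof (cases "j < n - p")
  case True
  then have "j + p < n" by simp
  then have "min (y (j + p) + d) a \<le> min (z (j + p) + e) a" using le[of "j + p"] d by auto
  then show ?thesis using True by (auto simp: pullback_def intro: lam_mono)
next
  case False
  then have *: "j + p - n < n" using assms by simp
  then have "min (y (j + p - n) + d) a \<le> min (z (j + p - n) + e) a" using le[OF *] d by auto
  then have "rho (min (z (j + p - n) + e) a) \<le> rho (min (y (j + p - n) + d) a)"
    using pullback_arg[OF y(1) * d(1)] pullback_arg[OF y(2) *, of e] d by (intro rho_antimono) auto
  then have "kap (rho (min (y (j + p - n) + d) a)) \<le> kap (rho (min (z (j + p - n) + e) a))"
    using pullback_arg[OF y(1) * d(1)] pullback_arg[OF y(2) *, of e] d
    by (intro kap_antimono rho(1)) auto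
  then show ?thesis using False by (simp add: pullback_def)
qed

lemma pullback_maps:
  assumes y: "y \<in> monotone_vectors n A a" and d: "0 \<le> d" and "0 < p" "p < n"
  shows "pullback n p d y \<in> monotone_vectors n A a"
proof -
  have low: "pullback n p d y j \<in> {A..c}" if "j < n - p" for j
    using that lam(1)[of "min (y (j + p) + d) a"] by (simp add: pullback_def)
  have high: "pullback n p d y j \<in> {c..a}" if "\<not> j < n - p" "j < n" for j
  proof -
    have "j + p - n < n" using that assms by simp
    from kap(1)[OF rho(1)[OF pullback_arg[OF y this d]]] that show ?thesis by (simp add: pullback_def)
  qed
  show ?thesis
    unfolding monotone_vectors_def
  proof (intro CollectI conjI allI impI)
    fix j assume "j < n"
    then show "A \<le> pullback n p d y j" "pullback n p d y j \<le> a"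
      using low[of j] high[of j] A_le_c c_less_a by (cases "j < n - p"; force)+
  next
    fix i j :: nat assume ij: "i \<le> j" "j < n"
    have ymono: "y k \<le> y l" if "k \<le> l" "l < n" for k l
      using y that by (auto simp: monotone_vectors_def)
    consider "j < n - p" | "i < n - p" "\<not> j < n - p" | "\<not> i < n - p" using ij by linarith
    then show "pullback n p d y i \<le> pullback n p d y j"
    proof cases
      case 1
      have "min (y (i + p) + d) a \<le> min (y (j + p) + d) a"
        using ymono[of "i + p" "j + p"] ij less_diff_conv[of j n p] 1 by (intro min.mono) auto
      then show ?thesis using 1 ij by (auto simp: pullback_def intro: lam_mono)
    next
      case 2
      then show ?thesis using low[of i] high[of j] ij by force
    next
      case 3
      have *: "i + p - n < n" "j + p - n < n" using 3 ij assms by auto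
      have "min (y (i + p - n) + d) a \<le> min (y (j + p - n) + d) a"
        using ymono[of "i + p - n" "j + p - n"] ij * by (intro min.mono) auto
      then show ?thesis using 3 ij pullback_arg[OF y *(1) d] pullback_arg[OF y *(2) d]
        by (auto simp: pullback_def intro!: kap_antimono rho_antimono rho(1))
    qed
  qed
qed

end

section \<open>When cycles must turn faster than a given rotation\<close>

context folded begin

text \<open>
  The last condition says that points of \<open>{c..a}\<close> visit the right side, as they do for a unimodal map.
\<close>
definition admissible :: "real set \<Rightarrow> bool" where
  "admissible Q \<longleftrightarrow> sided_cycle g a Q \<and> Q \<subseteq> {A..B} \<and> (\<forall>y\<in>Q. y < a \<longrightarrow> g y < a \<longrightarrow> y < c)"

text \<open>
  With \<open>l\<close> points on the left and \<open>r\<close> on the right the inequality reads \<open>r / l \<ge> (p + 1 / L) / n\<close>: the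
  frequency of wrapping around exceeds \<open>p / n\<close> by an amount that does not depend on the cycle.
\<close>
abbreviation frequency_gap :: "nat \<Rightarrow> nat \<Rightarrow> bool" where
  "frequency_gap n p \<equiv> \<exists>L>0. \<forall>Q. admissible Q \<longrightarrow>
     int (card (left_part a Q))
       \<le> int L * (int n * int (card (right_part a Q)) - int p * int (card (left_part a Q)))"

text \<open>
  Beyond a last exit \<open>x\<^sub>j\<close> the values of the branch are at least its target, so a step from a position \<open>j\<close> on that
  branch reaches at least position \<open>j + p\<close>. A step that visits the right side from a position below \<open>n - p\<close>
  wraps around and gains more than \<open>p\<close>. The condition \<open>x 0 = A\<close> gives every point of the cycle a position.
\<close>
lemma position_gain:
  assumes Q: "admissible Q" and y: "y \<in> left_part a Q"
    and x: "x \<in> monotone_vectors n A a" and d: "0 \<le> d" and pn: "0 < p" "p < n"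
    and fix_x: "\<And>j. j < n \<Longrightarrow> x j = pullback n p d x j"
    and x0: "x 0 = A"
  shows "position x n y + p \<le> position x n (left_return g a y) + n * (if a < g y then 1 else 0)"
proof -
  have sQ: "sided_cycle g a Q" and QAB: "Q \<subseteq> {A..B}" using Q by (auto simp: admissible_def)
  have yQ: "y \<in> Q" "y < a" "A \<le> y" using y QAB by auto
  have gy: "g y \<in> Q" "g y \<noteq> a" "A \<le> g y" "g y \<le> B"
    using sided_cycleD(4)[OF sQ yQ(1)] sided_cycleD(5)[OF sQ] QAB by auto
  let ?j = "position x n y"
  have j: "?j < n" "x ?j \<le> y" using position[of n x y] pn x0 yQ by auto
  show ?thesis
  proof (cases "a < g y")
    case False
    then have lt: "g y < a" using gy by simp
    then have "y < c" using Q yQ by (auto simp: admissible_def)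
    have jn: "?j < n - p"
    proof (rule ccontr)
      assume *: "\<not> ?j < n - p"
      then have "?j + p - n < n" using j pn by simp
      then have "c \<le> x ?j"
        using fix_x[OF j(1)] * kap(1)[OF rho(1)[OF pullback_arg[OF x _ d]]]
        by (simp add: pullback_def)
      with j \<open>y < c\<close> show False by simp
    qed
    then have xj: "x ?j = lam (min (x (?j + p) + d) a)" using fix_x[OF j(1)] by (simp add: pullback_def)
    have "min (x (?j + p) + d) a \<le> g y"
      using lam(2)[of "min (x (?j + p) + d) a" y] xj j(2) yQ \<open>y < c\<close> by simp
    then have "x (?j + p) \<le> g y" using lt d by (auto simp: min_def split: if_splits)
    then have "?j + p \<le> position x n (g y)" using jn by (intro position_ge) auto
    then show ?thesis using False by (simp add: left_return_def)
  next
    case True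
    have ggy: "g (g y) \<in> Q" "g (g y) < a"
      using sided_cycleD(4)[OF sQ gy(1)] sided_cycleD(7)[OF sQ gy(1) True] by auto
    show ?thesis
    proof (cases "?j < n - p")
      case less: True
      then show ?thesis using True by simp
    next
      case nl: False
      then have k: "?j + p - n < n" using j pn by simp
      let ?v = "min (x (?j + p - n) + d) a"
      have v: "?v \<in> {A..a}" by (rule pullback_arg[OF x k d])
      have xj: "x ?j = kap (rho ?v)" using fix_x[OF j(1)] nl by (simp add: pullback_def)
      have "c \<le> x ?j" unfolding xj using kap(1)[OF rho(1)[OF v]] by simp
      then have "g y \<le> rho ?v"
        using kap(3)[OF rho(1)[OF v], of y] j(2) yQ unfolding xj[symmetric] by simp
      then have "?v \<le> g (g y)" using rho(3)[OF v, of "g y"] True gy by simp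
      then have "x (?j + p - n) \<le> g (g y)" using ggy d by (auto simp: min_def split: if_splits)
      then have "?j + p - n \<le> position x n (g (g y))" using k by (intro position_ge) auto
      then show ?thesis using True by (simp add: left_return_def)
    qed
  qed
qed

text \<open>
  Clamped means that the target of \<open>x\<^sub>0\<close> is not attained on \<open>{A..c}\<close>. If there were cycles with frequency
  close to \<open>p / n\<close>, one of them would make \<open>n * K\<close> steps that gain exactly \<open>p\<close>. As \<open>K * d\<close> exceeds the length of the
  interval, some \<open>n\<close> consecutive steps \<open>s, \<dots>, s + n\<close> of these move the point up by at most \<open>d\<close>. Sorted by position,
  the points visited satisfy \<open>y \<le> pullback n p d y\<close>, so they lie below \<open>x\<close>. But the one in position 0
  is a point of \<open>{A..c}\<close> whose image is at most \<open>x\<^sub>p + d\<close>, which being clamped excludes.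
\<close>
lemma frequency_gap_if_clamped:
  assumes pn: "0 < p" "p < n" "coprime p n" and d: "0 < d"
    and x: "x \<in> monotone_vectors n A a"
    and fix_x: "\<And>j. j < n \<Longrightarrow> x j = pullback n p d x j"
    and greatest: "\<And>y j. \<lbrakk>y \<in> monotone_vectors n A a; \<And>i. i < n \<Longrightarrow> y i \<le> pullback n p d y i; j < n\<rbrakk>
        \<Longrightarrow> y j \<le> x j"
    and clamped: "\<And>y. y \<in> {A..c} \<Longrightarrow> min (x p + d) a < g y"
  shows "frequency_gap n p"
proof -
  have n0: "0 < n" using pn by simp
  have x0: "x 0 = A"
  proof -
    have "x 0 = lam (min (x p + d) a)" using fix_x[OF n0] pn by (simp add: pullback_def)
    also have "\<dots> = A" using clamped by (force simp: lam_def)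
    finally show ?thesis .
  qed
  \<comment> \<open>The return map cannot climb by more than \<open>d\<close> in \<open>K\<close> successive rounds of \<open>n\<close> steps.\<close>
  obtain K :: nat where K: "a - A < real K * d" using ex_less_of_nat_mult[OF d] by blast
  have K0: "0 < K" using K A_le_c c_less_a by (cases K) auto
  define L where "L = n * K"
  show ?thesis
  proof (intro exI[of _ L] conjI allI impI)
    show "0 < L" using n0 K0 by (simp add: L_def)
    fix Q assume Q: "admissible Q"
    then have sQ: "sided_cycle g a Q" and QAB: "Q \<subseteq> {A..B}" by (auto simp: admissible_def)
    let ?S = "left_part a Q" and ?R = "left_return g a"
    let ?w = "\<lambda>y. if a < g y then 1 else (0::nat)"
    show "int (card ?S) \<le> int L * (int n * int (card (right_part a Q)) - int p * int (card ?S))"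
    proof (rule ccontr)
      assume "\<not> ?thesis"
      then have small: "int L * (int n * int (\<Sum>y\<in>?S. ?w y) - int p * int (card ?S)) < int (card ?S)"
        unfolding sided_cycle_crossing_sum[OF sQ] by linarith
      have fin: "finite ?S" using sided_cycleD(1)[OF sQ] by simp
      have gain: "position x n y + p \<le> position x n (?R y) + n * ?w y" if "y \<in> ?S" for y
        using position_gain[OF Q that x _ pn(1,2) fix_x x0] d by simp
      obtain y0 where y0: "y0 \<in> ?S"
        and tight: "\<And>i. i < L \<Longrightarrow>
          position x n (?R ((?R ^^ i) y0)) + n * ?w ((?R ^^ i) y0) = position x n ((?R ^^ i) y0) + p"
        using drift_window[OF fin left_return_bij[OF sQ] gain small] by metis
      define u where "u i = (?R ^^ i) y0" for i
      define P where "P i = position x n (u i)" for i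
      have u: "u i \<in> ?S" for i
        using bij_betw_funpow[OF left_return_bij[OF sQ], of i] y0 unfolding u_def
        by (auto dest: bij_betwE)
      have uSuc: "u (Suc i) = ?R (u i)" for i by (simp add: u_def)
      have uA: "A \<le> u i" "u i < a" for i using u[of i] QAB by auto
      have Pn: "P i < n" "x (P i) \<le> u i" for i
        using position[OF n0, of x "u i"] x0 uA by (auto simp: P_def)
      have tight': "P (Suc i) + n * ?w (u i) = P i + p" if "i < L" for i
        using tight[OF that] by (simp add: u_def P_def)
      have PSuc: "P (Suc i) = (P i + p) mod n" if "i < L" for i
      proof -
        have "(P i + p) mod n = (P (Suc i) + n * ?w (u i)) mod n" using tight'[OF that] by simp
        then show ?thesis using Pn(1)[of "Suc i"] by simp
      qed
      have Padd: "P (s + i) = (P s + i * p) mod n" if "s + i \<le> L" for s i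
        using that
      proof (induction i)
        case (Suc i)
        then show ?case using PSuc[of "s + i"] by (simp add: mod_simps ac_simps)
      qed (use Pn(1) in simp)
      have "\<exists>k<K. u (Suc k * n) \<le> u (k * n) + d"
      proof (rule ccontr)
        assume "\<not> ?thesis"
        then have *: "u (k * n) + d < u (Suc k * n)" if "k < K" for k using that by force
        have "u 0 + real k * d \<le> u (k * n)" if "k \<le> K" for k
          using that
        proof (induction k)
          case (Suc k)
          then show ?case using *[of k] by (simp add: algebra_simps)
        qed simp
        from this[of K] K uA[of "K * n"] uA[of 0] show False by simp
      qed
      then obtain k where k: "k < K" "u (Suc k * n) \<le> u (k * n) + d" by blast
      define s where "s = k * n"
      have sL: "s + n \<le> L"
        using k(1) mult_le_mono2[of "Suc k" K n] by (simp add: s_def L_def mult.commute)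
      have usn: "u (s + n) \<le> u s + d" using k(2) by (simp add: s_def add.commute)
      \<comment> \<open>The time, counted from \<open>s\<close>, at which the orbit is in position \<open>j\<close>.\<close>
      define idx where "idx j = (SOME i. i < n \<and> P (s + i) = j)" for j
      have Pbij: "bij_betw (\<lambda>i. P (s + i)) {..<n} {..<n}"
        using coprime_multiples_bij[OF pn(3) n0, of "P s"] Padd[of s] sL
        by (subst bij_betw_cong[where g = "\<lambda>i. (P s + i * p) mod n"]) auto
      have idx: "idx j < n" "P (s + idx j) = j" if "j < n" for j
      proof -
        have "j \<in> (\<lambda>i. P (s + i)) ` {..<n}" using Pbij that by (simp add: bij_betw_imp_surj_on)
        then have "\<exists>i. i < n \<and> P (s + i) = j" by blast
        from someI_ex[OF this] show "idx j < n" "P (s + idx j) = j" by (auto simp: idx_def)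
      qed
      have idx_eq: "idx j = i" if "i < n" "P (s + i) = j" for i j
      proof -
        have "j < n" using Pn(1)[of "s + i"] that by simp
        from idx[OF this] that bij_betw_imp_inj_on[OF Pbij] show ?thesis
          by (auto simp: inj_on_def)
      qed
      define y where "y j = u (s + idx j)" for j
      \<comment> \<open>Within the round this holds without \<open>d\<close>; the last step of the round closes up only to within \<open>d\<close>.\<close>
      have ystep: "u (Suc (s + idx j)) \<le> y ((j + p) mod n) + d" if "j < n" for j
      proof -
        let ?i = "idx j"
        have Pj: "P (s + Suc ?i) = (j + p) mod n" using PSuc[of "s + ?i"] idx[OF that] sL by simp
        show ?thesis
        proof (cases "Suc ?i < n")
          case True
          then have "idx ((j + p) mod n) = Suc ?i" using Pj by (rule idx_eq)
          then show ?thesis using d by (simp add: y_def)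
        next
          case False
          then have i: "Suc ?i = n" using idx(1)[OF that] by simp
          then have "P (s + n) = (j + p) mod n" using Pj by simp
          moreover have "P (s + n) = P s" using Padd[OF sL] Pn(1)[of s] by simp
          ultimately have "idx ((j + p) mod n) = 0" using n0 by (intro idx_eq) auto
          then have y: "y ((j + p) mod n) = u s" by (simp add: y_def)
          have "Suc (s + ?i) = s + n" using i by simp
          then show ?thesis unfolding y using usn by (simp only:)
        qed
      qed
      have tj: "P (Suc (s + idx j)) + n * ?w (u (s + idx j)) = j + p" if "j < n" for j
        using tight'[of "s + idx j"] idx[OF that] sL by simp
      have yV: "y \<in> monotone_vectors n A a"
        unfolding monotone_vectors_def
      proof (intro CollectI conjI allI impI)
        fix i j :: nat assume ij: "i \<le> j" "j < n"
        show "y i \<le> y j"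
        proof (cases "i = j")
          case False
          then have "P (s + idx i) < P (s + idx j)" using idx(2) ij by simp
          then show ?thesis unfolding P_def y_def
            using position_less_less[OF n0, of x "u (s + idx i)" "u (s + idx j)"] x0 uA by simp
        qed simp
      qed (use uA in \<open>auto simp: y_def intro: less_imp_le\<close>)
      \<comment> \<open>The points of the cycle are in the fibres, so they do not exceed the last exits.\<close>
      have y_le: "y j \<le> pullback n p d y j" if j: "j < n" for j
      proof (cases "j < n - p")
        case True
        let ?u = "u (s + idx j)"
        have "\<not> a < g ?u"
        proof
          assume "a < g ?u"
          then have "P (Suc (s + idx j)) + n = j + p" using tj[OF j] by simp
          with True show False by simp
        qed
        moreover have "?u \<in> Q" "?u < a" "A \<le> ?u" using u[of "s + idx j"] uA by auto
        moreover have "g ?u \<noteq> a" using sided_cycleD(4,5)[OF sQ] \<open>?u \<in> Q\<close> by blast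
        ultimately have lt: "g ?u < a" "?u < c" using Q by (auto simp: admissible_def)
        have "u (Suc (s + idx j)) = g ?u" using \<open>\<not> a < g ?u\<close> by (simp add: uSuc left_return_def)
        then have "g ?u \<le> min (y (j + p) + d) a" using ystep[OF j] True lt(1) by simp
        then have "?u \<le> lam (min (y (j + p) + d) a)" using lt(2) \<open>A \<le> ?u\<close> by (intro lam(3)) auto
        then show ?thesis using True by (simp add: pullback_def y_def)
      next
        case False
        let ?u = "u (s + idx j)"
        have k: "j + p - n < n" using j pn by simp
        have jmod: "(j + p) mod n = j + p - n" using False j pn by (simp add: mod_if)
        have w: "a < g ?u"
        proof (rule ccontr)
          assume "\<not> a < g ?u"
          then have "P (Suc (s + idx j)) = j + p" using tj[OF j] by simp
          with Pn(1)[of "Suc (s + idx j)"] False j show False by simp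
        qed
        have uQ: "?u \<in> Q" using u[of "s + idx j"] by auto
        have gu: "g ?u \<in> Q" using sided_cycleD(4)[OF sQ uQ] .
        let ?v = "min (y (j + p - n) + d) a"
        have v: "?v \<in> {A..a}" using d by (intro pullback_arg[OF yV k]) simp
        have "u (Suc (s + idx j)) = g (g ?u)" using w by (simp add: uSuc left_return_def)
        then have "g (g ?u) \<le> ?v" using ystep[OF j] jmod uA(2)[of "Suc (s + idx j)"] by simp
        then have "rho ?v \<le> g ?u" using w gu QAB by (intro rho(4)[OF v]) auto
        moreover have "c \<le> ?u"
        proof -
          have "x j = kap (rho (min (x (j + p - n) + d) a))"
            using fix_x[OF j] False by (simp add: pullback_def)
          then have "c \<le> x j"
            using kap(1)[OF rho(1)[OF pullback_arg[OF x k, of d]]] d by simp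
          also have "x j \<le> ?u" using Pn(2)[of "s + idx j"] idx(2)[OF j] by simp
          finally show ?thesis .
        qed
        ultimately have "?u \<le> kap (rho ?v)" using uA[of "s + idx j"]
          by (intro kap(4)[OF rho(1)[OF v]]) auto
        then show ?thesis using False by (simp add: pullback_def y_def)
      qed
      have "y p \<le> x p" by (rule greatest[OF yV y_le pn(2)])
      let ?u = "u (s + idx 0)"
      have "\<not> a < g ?u"
      proof
        assume "a < g ?u"
        then have "P (Suc (s + idx 0)) + n = p" using tj[OF n0] by simp
        with pn show False by simp
      qed
      moreover have "?u \<in> Q" "?u < a" "A \<le> ?u" using u[of "s + idx 0"] uA by auto
      moreover have "g ?u \<noteq> a" using sided_cycleD(4,5)[OF sQ] \<open>?u \<in> Q\<close> by blast
      ultimately have lt: "g ?u < a" "?u < c" using Q by (auto simp: admissible_def)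
      have "u (Suc (s + idx 0)) = g ?u" using \<open>\<not> a < g ?u\<close> by (simp add: uSuc left_return_def)
      then have "g ?u \<le> min (x p + d) a"
        using ystep[OF n0] \<open>y p \<le> x p\<close> lt(1) pn(2) by simp
      moreover have "min (x p + d) a < g ?u" using lt(2) \<open>A \<le> ?u\<close> by (intro clamped) auto
      ultimately show False by linarith
    qed
  qed
qed

end

section \<open>Cycles that the return map rotates\<close>

text \<open>
  The points \<open>x\<^sub>j\<close> with \<open>n - p \<le> j\<close> are those that visit the right side, where the order of their images is reversed.
\<close>
definition gamma_orbit :: "(real \<Rightarrow> real) \<Rightarrow> real \<Rightarrow> nat \<Rightarrow> nat \<Rightarrow> (nat \<Rightarrow> real) \<Rightarrow> bool" where
  "gamma_orbit g a n p x \<longleftrightarrow>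
     (\<forall>i j. i < j \<longrightarrow> j < n \<longrightarrow> x i < x j) \<and> (\<forall>j<n. x j < a) \<and>
     (\<forall>j<n - p. g (x j) = x (j + p)) \<and>
     (\<forall>j. n - p \<le> j \<longrightarrow> j < n \<longrightarrow> a < g (x j) \<and> g (g (x j)) = x (j + p - n)) \<and>
     (\<forall>i j. n - p \<le> i \<longrightarrow> i < j \<longrightarrow> j < n \<longrightarrow> g (x j) < g (x i))"

lemma gamma_pattern_nat:
  assumes "p \<le> n" "i \<in> {1..n + p}"
  shows "gamma_pattern p (n + p) i =
    (if i \<le> n - p then i + p else if i \<le> n then 2 * n + 1 - i else n + p + 1 - i)"
  using assms by (auto simp: gamma_pattern_def phi_num_def nat_diff_distrib)

text \<open>
  The reflection of the right block: it turns the pattern on \<open>{1..n + p}\<close> into a rotation of \<open>{0..<n + p}\<close>.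
\<close>
definition unfold_index :: "nat \<Rightarrow> nat \<Rightarrow> nat \<Rightarrow> nat" where
  "unfold_index n p t = (if t < n then t + 1 else 2 * n + p - t)"

lemma gamma_pattern_rotation:
  assumes "0 < p" "p \<le> n" "t < n + p"
  shows "gamma_pattern p (n + p) (unfold_index n p t) = unfold_index n p ((t + p) mod (n + p))"
proof -
  have i: "unfold_index n p t \<in> {1..n + p}" using assms by (auto simp: unfold_index_def)
  consider "t < n - p" | "n - p \<le> t" "t < n" | "n \<le> t" by linarith
  then show ?thesis
  proof cases
    case 1
    then have "(t + p) mod (n + p) = t + p" using assms by simp
    then show ?thesis using 1 assms by (simp add: gamma_pattern_nat[OF assms(2) i]) (auto simp: unfold_index_def)
  next
    case 2
    then have "(t + p) mod (n + p) = t + p" using assms by simp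
    then show ?thesis using 2 assms by (simp add: gamma_pattern_nat[OF assms(2) i]) (auto simp: unfold_index_def)
  next
    case 3
    then have "(t + p) mod (n + p) = t - n" using assms by (simp add: mod_if)
    then show ?thesis using 3 assms by (simp add: gamma_pattern_nat[OF assms(2) i]) (auto simp: unfold_index_def)
  qed
qed

lemma gamma_pattern_pattern:
  assumes p: "0 < p" "p \<le> n" and cop: "coprime p n"
  shows "pattern (n + p) (gamma_pattern p (n + p))"
proof -
  let ?q = "n + p" and ?g = "gamma_pattern p (n + p)" and ?t = "unfold_index n p"
  have q0: "0 < ?q" using p by simp
  have copq: "coprime p ?q" using cop by (simp add: coprime_iff_gcd_eq_1 add.commute[of n p])
  have img: "?t ` {..<?q} = {1..?q}"
  proof (intro equalityI subsetI)
    fix i assume i: "i \<in> {1..?q}"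
    show "i \<in> ?t ` {..<?q}"
    proof (cases "i \<le> n")
      case True
      then have "i = ?t (i - 1)" "i - 1 < ?q" using i by (auto simp: unfold_index_def)
      then show ?thesis by blast
    next
      case False
      then have "i = ?t (2 * n + p - i)" "2 * n + p - i < ?q" using i by (auto simp: unfold_index_def)
      then show ?thesis by blast
    qed
  qed (use p in \<open>auto simp: unfold_index_def\<close>)
  have pow: "(?g ^^ i) (?t 0) = ?t ((0 + i * p) mod ?q)" for i
  proof (induction i)
    case (Suc i)
    have "(?g ^^ Suc i) (?t 0) = ?g (?t ((0 + i * p) mod ?q))" using Suc by simp
    also have "\<dots> = ?t (((0 + i * p) mod ?q + p) mod ?q)"
      using p q0 by (intro gamma_pattern_rotation) auto
    finally show ?case by (simp add: mod_simps add.commute)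
  qed simp
  have orb: "orbit ?g (?t 0) = {1..?q}"
  proof (intro equalityI subsetI)
    fix i assume "i \<in> orbit ?g (?t 0)"
    then obtain k where "i = (?g ^^ k) (?t 0)" by (auto simp: orbit_altdef)
    then show "i \<in> {1..?q}" using img q0 unfolding pow by (metis imageI lessThan_iff mod_less_divisor)
  next
    fix i assume "i \<in> {1..?q}"
    then obtain t where t: "t < ?q" "i = ?t t" using img by (metis imageE lessThan_iff)
    then have "t \<in> (\<lambda>i. (0 + i * p) mod ?q) ` {..<?q}"
      using coprime_multiples_bij[OF copq q0, of 0] by (simp add: bij_betw_imp_surj_on)
    then obtain k where k: "t = (0 + k * p) mod ?q" by blast
    have "0 + (k + ?q) * p = (0 + k * p) + p * ?q" by (simp add: algebra_simps)
    then have "t = (0 + (k + ?q) * p) mod ?q" by (simp only: mod_mult_self1 k)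
    then have "i = (?g ^^ (k + ?q)) (?t 0)" unfolding pow using t by simp
    then show "i \<in> orbit ?g (?t 0)" unfolding orbit_altdef using q0 by blast
  qed
  have "?t 0 \<in> {1..?q}" using img q0 by (metis imageI lessThan_iff)
  then have cyc: "cyclic_on ?g {1..?q}" unfolding cyclic_on_def using orb by auto
  have surj: "?g ` {1..?q} = {1..?q}"
  proof (intro equalityI subsetI)
    fix i assume "i \<in> ?g ` {1..?q}"
    then show "i \<in> {1..?q}" using cyclic_on_f_in[OF _ cyc] cyc
      by (metis cyclic_on_alldef imageE orbit_step orb cyclic_on_inI orbit.base)
  next
    fix i assume "i \<in> {1..?q}"
    then obtain t where t: "t < ?q" "i = ?t t" using img by (metis imageE lessThan_iff)
    define s where "s = (t + n) mod ?q"
    have "(s + p) mod ?q = (t + ?q) mod ?q" by (simp add: s_def mod_simps add.assoc)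
    then have "?g (?t s) = i"
      using t q0 p gamma_pattern_rotation[of p n s] by (simp add: s_def)
    moreover have "?t s \<in> {1..?q}" using img q0 by (metis s_def imageI lessThan_iff mod_less_divisor)
    ultimately show "i \<in> ?g ` {1..?q}" by blast
  qed
  then have "bij_betw ?g {1..?q} {1..?q}" by (simp add: bij_betw_def eq_card_imp_inj_on)
  moreover have "?g i = i" if "i \<notin> {1..?q}" for i
    unfolding gamma_pattern_def using that by (rule if_not_P)
  ultimately have "?g permutes {1..?q}" by (rule bij_imp_permutes)
  with cyc show ?thesis by (simp add: pattern_def)
qed

lemma gamma_orbit_exhibits:
  assumes p: "0 < p" "p \<le> n" and cop: "coprime p n" and x: "gamma_orbit g a n p x"
    and sub: "x ` {..<n} \<union> g ` x ` {n - p..<n} \<subseteq> {lo..hi}"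
  shows "exhibits_on g lo hi (x ` {..<n} \<union> g ` x ` {n - p..<n}) (gamma_pattern p (n + p))"
proof -
  let ?P = "x ` {..<n} \<union> g ` x ` {n - p..<n}"
  define h where "h i = (if i \<le> n then x (i - 1) else g (x (2 * n - i)))" for i
  have X: "\<And>i j. i < j \<Longrightarrow> j < n \<Longrightarrow> x i < x j" "\<And>j. j < n \<Longrightarrow> x j < a"
    "\<And>j. j < n - p \<Longrightarrow> g (x j) = x (j + p)"
    "\<And>j. n - p \<le> j \<Longrightarrow> j < n \<Longrightarrow> a < g (x j)"
    "\<And>j. n - p \<le> j \<Longrightarrow> j < n \<Longrightarrow> g (g (x j)) = x (j + p - n)"
    "\<And>i j. n - p \<le> i \<Longrightarrow> i < j \<Longrightarrow> j < n \<Longrightarrow> g (x j) < g (x i)"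
    using x unfolding gamma_orbit_def by blast+
  have mono: "strict_mono_on {1..n + p} h"
  proof (rule strict_mono_onI)
    fix i j assume ij: "i \<in> {1..n + p}" "j \<in> {1..n + p}" "i < j"
    consider "j \<le> n" | "i \<le> n" "n < j" | "n < i" using ij by linarith
    then show "h i < h j"
    proof cases
      case 1
      then show ?thesis using X(1)[of "i - 1" "j - 1"] ij by (simp add: h_def)
    next
      case 2
      have "x (i - 1) < a" "a < g (x (2 * n - j))"
        using X(2)[of "i - 1"] X(4)[of "2 * n - j"] 2 ij p by auto
      then show ?thesis using 2 by (simp add: h_def)
    next
      case 3
      then show ?thesis using X(6)[of "2 * n - j" "2 * n - i"] ij p by (simp add: h_def)
    qed
  qed
  have img: "h ` {1..n + p} = ?P"
  proof (intro equalityI subsetI)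
    fix y assume "y \<in> h ` {1..n + p}"
    then obtain i where i: "i \<in> {1..n + p}" "y = h i" by blast
    show "y \<in> ?P"
    proof (cases "i \<le> n")
      case True
      then have "y = x (i - 1)" "i - 1 < n" using i by (auto simp: h_def)
      then show ?thesis by blast
    next
      case False
      then have "y = g (x (2 * n - i))" "2 * n - i \<in> {n - p..<n}" using i p by (auto simp: h_def)
      then show ?thesis by blast
    qed
  next
    fix y assume "y \<in> ?P"
    then consider j where "j < n" "y = x j" | j where "j \<in> {n - p..<n}" "y = g (x j)" by auto
    then show "y \<in> h ` {1..n + p}"
    proof cases
      case 1
      then have "y = h (j + 1)" "j + 1 \<in> {1..n + p}" by (auto simp: h_def)
      then show ?thesis by blast
    next
      case 2
      then have "y = h (2 * n - j)" "2 * n - j \<in> {1..n + p}" by (auto simp: h_def)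
      then show ?thesis by blast
    qed
  qed
  have conj: "g (h i) = h (gamma_pattern p (n + p) i)" if i: "i \<in> {1..n + p}" for i
  proof -
    consider "i \<le> n - p" | "n - p < i" "i \<le> n" | "n < i" using i by linarith
    then show ?thesis
    proof cases
      case 1
      then have "i - 1 < n - p" "i \<le> n" "i + p \<le> n" "i - 1 + p = i + p - 1" using i p by auto
      then show ?thesis using X(3)[of "i - 1"] 1 i p by (simp add: gamma_pattern_nat h_def)
    next
      case 2
      then have "2 * n - (2 * n + 1 - i) = i - 1" "n < 2 * n + 1 - i" using i by auto
      then show ?thesis using 2 i p by (simp add: gamma_pattern_nat h_def)
    next
      case 3
      then have "g (g (x (2 * n - i))) = x (2 * n - i + p - n)" using i p by (intro X(5)) auto
      moreover have "2 * n - i + p - n = n + p + 1 - i - 1" "n + p + 1 - i \<le> n" using 3 i p by auto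
      moreover have "\<not> i \<le> n" "\<not> i \<le> n - p" using 3 by auto
      ultimately show ?thesis using 3 i p by (simp add: gamma_pattern_nat h_def)
    qed
  qed
  show ?thesis
    unfolding exhibits_on_def
    using sub gamma_pattern_pattern[OF p cop] mono img conj by blast
qed

context folded begin

text \<open>
  Coincidences or contact with \<open>a\<close> would be propagated by \<open>g\<close> along the rotation, hence, \<open>p\<close> and \<open>n\<close> being coprime, to
  all positions. They cannot occur at position 0, which is at most \<open>c\<close>, nor between the positions \<open>n - p - 1\<close> and
  \<open>n - p\<close>, where the image jumps from at most \<open>a\<close> to above \<open>a\<close>.
\<close>
lemma gamma_orbit_of_weak:
  assumes pn: "0 < p" "p < n" "coprime p n"
    and x: "x \<in> monotone_vectors n A a"
    and low: "\<And>j. j < n - p \<Longrightarrow> x j \<le> c" "\<And>j. j < n - p \<Longrightarrow> g (x j) = x (j + p)"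
    and high: "\<And>j. n - p \<le> j \<Longrightarrow> j < n \<Longrightarrow> c \<le> x j" "\<And>j. n - p \<le> j \<Longrightarrow> j < n \<Longrightarrow> a \<le> g (x j)"
      "\<And>j. n - p \<le> j \<Longrightarrow> j < n \<Longrightarrow> g (g (x j)) = x (j + p - n)"
    and anti: "\<And>i j. n - p \<le> i \<Longrightarrow> i \<le> j \<Longrightarrow> j < n \<Longrightarrow> g (x j) \<le> g (x i)"
  shows "gamma_orbit g a n p x"
proof -
  have n0: "0 < n" using pn by simp
  have xle: "x j \<le> a" if "j < n" for j using x that by (simp add: monotone_vectors_def)
  have xmono: "x i \<le> x j" if "i \<le> j" "j < n" for i j using x that by (simp add: monotone_vectors_def)
  have lt: "x j < a" if "j < n" for j
  proof (rule ccontr)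
    assume "\<not> x j < a"
    then have j: "j \<in> {j. j < n \<and> x j = a}" using xle[OF that] that by simp
    have "0 \<in> {j. j < n \<and> x j = a}"
    proof (rule rotation_invariant_all[OF pn(3) n0 j that _ n0])
      fix i assume i: "i \<in> {j. j < n \<and> x j = a}" "i < n"
      then have "\<not> i < n - p" using low(1)[of i] c_less_a by auto
      moreover have "(i + p) mod n = i + p - n" using calculation i pn by (simp add: mod_if)
      ultimately show "(i + p) mod n \<in> {j. j < n \<and> x j = a}"
        using high(3)[of i] i pn g_a by simp
    qed
    then show False using low(1)[of 0] pn c_less_a by simp
  qed
  have ne: "x j \<noteq> x (j + 1)" if "j + 1 < n" for j
  proof
    assume "x j = x (j + 1)"
    then have j: "j \<in> {j. j + 1 < n \<and> x j = x (j + 1)}" "j < n" using that by auto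
    have mid: "n - p - 1 \<notin> {j. j + 1 < n \<and> x j = x (j + 1)}"
    proof
      assume "n - p - 1 \<in> {j. j + 1 < n \<and> x j = x (j + 1)}"
      moreover have "n - p - 1 + 1 = n - p" using pn by simp
      ultimately have *: "x (n - p - 1) = x (n - p)" by (metis (mono_tags, lifting) mem_Collect_eq)
      then have "x (n - p - 1) = c" using low(1)[of "n - p - 1"] high(1)[of "n - p"] pn by simp
      then have "x (n - p - 1 + p) = B" using low(2)[of "n - p - 1"] pn g_c by simp
      then show False using xle[of "n - p - 1 + p"] pn a_less_B by simp
    qed
    have "n - p - 1 \<in> {j. j + 1 < n \<and> x j = x (j + 1)}"
    proof (rule rotation_invariant_all[OF pn(3) n0 j])
      fix i assume i: "i \<in> {j. j + 1 < n \<and> x j = x (j + 1)}" "i < n"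
      then have "i \<noteq> n - p - 1" using mid by metis
      then consider "i + 1 < n - p" | "n - p \<le> i" by linarith
      then show "(i + p) mod n \<in> {j. j + 1 < n \<and> x j = x (j + 1)}"
      proof cases
        case 1
        then show ?thesis using low(2)[of i] low(2)[of "i + 1"] i by (simp add: add.commute add.left_commute)
      next
        case 2
        then have "n \<le> i + p" "i + p - n < n" using i pn by auto
        then have "(i + p) mod n = i + p - n" by (simp add: le_mod_geq)
        moreover have "i + 1 + p - n = i + p - n + 1" "i + p - n + 1 < n" using 2 i pn by auto
        moreover have "x (i + p - n) = x (i + 1 + p - n)"
          using high(3)[of i] high(3)[of "i + 1"] i 2 by (metis (mono_tags, lifting) le_add1 le_trans mem_Collect_eq)
        ultimately show ?thesis by simp
      qed
    qed (use pn in simp)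
    with mid show False by blast
  qed
  have strict: "x i < x j" if "i < j" "j < n" for i j
    using xmono[of i "i + 1"] ne[of i] xmono[of "i + 1" j] that by force
  show ?thesis
    unfolding gamma_orbit_def
  proof (intro conjI allI impI)
    fix j assume j: "n - p \<le> j" "j < n"
    have k: "j + p - n < n" using j pn by simp
    show "g (g (x j)) = x (j + p - n)" using high(3) j by blast
    then have "g (x j) \<noteq> a" using lt[OF k] g_a by auto
    then show "a < g (x j)" using high(2)[OF j] by simp
  next
    fix i j assume ij: "n - p \<le> i" "i < j" "j < n"
    have "x (i + p - n) < x (j + p - n)" using ij pn by (intro strict) auto
    then have "g (x i) \<noteq> g (x j)" using high(3)[of i] high(3)[of j] ij by auto
    then show "g (x j) < g (x i)" using anti[of i j] ij by simp
  qed (use strict lt low(2) in auto)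
qed

text \<open>
  If the greatest solutions \<open>X k\<close> for the shifts \<open>d k = 1 / (k + 1)\<close> are all unclamped, they satisfy the equations of
  a gamma orbit up to \<open>d k\<close>. They decrease with \<open>k\<close> because a solution for a smaller shift is a subsolution for a larger one,
  and by continuity of \<open>g\<close> their limit is a gamma orbit.
\<close>
theorem gamma_orbit_or_gap:
  assumes pn: "0 < p" "p < n" "coprime p n"
  shows "(\<exists>x. gamma_orbit g a n p x \<and> (\<forall>j<n. A \<le> x j) \<and> (\<forall>j. n - p \<le> j \<longrightarrow> j < n \<longrightarrow> c \<le> x j \<and> g (x j) \<le> B)) \<or>
    frequency_gap n p"
proof (rule disjCI)
  assume no_gap: "\<not> frequency_gap n p"
  let ?V = "monotone_vectors n A a"
  define d :: "nat \<Rightarrow> real" where "d k = 1 / real (Suc k)" for k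
  have d: "0 < d k" "d (Suc k) \<le> d k" for k by (auto simp: d_def field_simps)
  have dlim: "d \<longlonglongrightarrow> 0" unfolding d_def using LIMSEQ_inverse_real_of_nat by (simp add: inverse_eq_divide)
  have "\<exists>x. x \<in> ?V \<and> (\<forall>j<n. x j = pullback n p (d k) x j) \<and>
      (\<forall>y j. y \<in> ?V \<longrightarrow> (\<forall>i<n. y i \<le> pullback n p (d k) y i) \<longrightarrow> j < n \<longrightarrow> y j \<le> x j) \<and>
      (\<exists>y\<in>{A..c}. g y \<le> min (x p + d k) a)" for k
  proof -
    obtain x where x: "x \<in> ?V" "\<And>j. j < n \<Longrightarrow> x j = pullback n p (d k) x j"
      "\<And>y j. \<lbrakk>y \<in> ?V; \<And>i. i < n \<Longrightarrow> y i \<le> pullback n p (d k) y i; j < n\<rbrakk> \<Longrightarrow> y j \<le> x j"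
    proof (rule greatest_monotone_fixpoint[of A a n "pullback n p (d k)"])
      show "A \<le> a" using A_le_c c_less_a by simp
      show "pullback n p (d k) y \<in> ?V" if "y \<in> ?V" for y
        using that d(1)[of k] pn by (intro pullback_maps) auto
      show "pullback n p (d k) y j \<le> pullback n p (d k) z j"
        if "y \<in> ?V" "z \<in> ?V" "\<And>i. i < n \<Longrightarrow> y i \<le> z i" "j < n" for y z j
        using that d(1)[of k] pn by (intro pullback_mono) auto
    qed blast
    have "\<exists>y\<in>{A..c}. g y \<le> min (x p + d k) a"
    proof (rule ccontr)
      assume "\<not> ?thesis"
      then have un: "\<And>y. y \<in> {A..c} \<Longrightarrow> min (x p + d k) a < g y" by force
      have "frequency_gap n p"
        by (rule frequency_gap_if_clamped[where x = x and d = "d k"]) (fact pn d(1) x un)+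
      with no_gap show False by blast
    qed
    with x show ?thesis by blast
  qed
  then obtain X where XV: "\<And>k. X k \<in> ?V"
    and Xfix: "\<And>k j. j < n \<Longrightarrow> X k j = pullback n p (d k) (X k) j"
    and Xgr: "\<And>k y j. y \<in> ?V \<Longrightarrow> (\<forall>i<n. y i \<le> pullback n p (d k) y i) \<Longrightarrow> j < n \<Longrightarrow> y j \<le> X k j"
    and Xun: "\<And>k. \<exists>y\<in>{A..c}. g y \<le> min (X k p + d k) a"
    by metis
  have XA: "A \<le> X k j" "X k j \<le> a" if "j < n" for k j
    using XV[of k] that by (auto simp: monotone_vectors_def)
  have Xmono: "X k i \<le> X k j" if "i \<le> j" "j < n" for i j k
    using XV[of k] that by (auto simp: monotone_vectors_def)
  have Xdec: "X (Suc k) j \<le> X k j" if "j < n" for k j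
  proof (rule Xgr[OF XV _ that], intro allI impI)
    fix i assume i: "i < n"
    have "X (Suc k) i = pullback n p (d (Suc k)) (X (Suc k)) i" by (rule Xfix[OF i])
    also have "\<dots> \<le> pullback n p (d k) (X (Suc k)) i"
      using d(1)[of "Suc k"] d(2)[of k] i pn by (intro pullback_mono XV) auto
    finally show "X (Suc k) i \<le> pullback n p (d k) (X (Suc k)) i" .
  qed
  have "\<exists>l. j < n \<longrightarrow> (\<lambda>k. X k j) \<longlonglongrightarrow> l" for j
  proof (cases "j < n")
    case True
    have "decseq (\<lambda>k. X k j)" using Xdec[OF True] by (intro decseq_SucI)
    then show ?thesis using decseq_convergent[of "\<lambda>k. X k j" A] XA[OF True] by metis
  qed simp
  then obtain x where lim: "\<And>j. j < n \<Longrightarrow> (\<lambda>k. X k j) \<longlonglongrightarrow> x j" by metis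
  have glim: "(\<lambda>k. g (Y k)) \<longlonglongrightarrow> g l" if "Y \<longlonglongrightarrow> l" "\<And>k. Y k \<in> {A..B}" for Y l
  proof (rule continuous_on_tendsto_compose[OF cont that(1)])
    show "l \<in> {A..B}" using closed_sequentially[OF closed_atLeastAtMost] that by blast
  qed (use that in simp)
  have vlim: "(\<lambda>k. min (X k j + d k) a) \<longlonglongrightarrow> x j" if "j < n" for j
  proof -
    have "(\<lambda>k. min (X k j + d k) a) \<longlonglongrightarrow> min (x j + 0) a"
      by (intro tendsto_min tendsto_add lim[OF that] dlim tendsto_const)
    moreover have "x j \<le> a" using LIMSEQ_le_const2[OF lim[OF that]] XA[OF that] by blast
    ultimately show ?thesis by simp
  qed
  have varg: "min (X k j + d k) a \<in> {A..a}" if "j < n" for k j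
    using pullback_arg[OF XV that, of "d k" k] d(1)[of k] by simp
  have low: "X k j \<le> c" "g (X k j) = min (X k (j + p) + d k) a" if "j < n - p" for k j
  proof -
    have eq: "X k j = lam (min (X k (j + p) + d k) a)"
      using Xfix[of j k] that by (simp add: pullback_def)
    show "X k j \<le> c" unfolding eq using lam(1)[of "min (X k (j + p) + d k) a"] by simp
    obtain y where y: "y \<in> {A..c}" "g y \<le> min (X k p + d k) a" using Xun by blast
    have "min (X k p + d k) a \<le> min (X k (j + p) + d k) a"
      using Xmono[of p "j + p" k] that less_diff_conv[of j n p] by (intro min.mono) auto
    then show "g (X k j) = min (X k (j + p) + d k) a"
      unfolding eq using y by (intro lam(4)[of _ y]) auto
  qed
  have high: "c \<le> X k j" "a \<le> g (X k j)" "g (X k j) \<le> B" "g (g (X k j)) = min (X k (j + p - n) + d k) a"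
    if "n - p \<le> j" "j < n" for k j
  proof -
    have m: "j + p - n < n" using that pn by simp
    have eq: "X k j = kap (rho (min (X k (j + p - n) + d k) a))"
      using Xfix[of j k] that by (simp add: pullback_def)
    note r = rho(1,2)[OF varg[OF m], of k]
    show "c \<le> X k j" unfolding eq using kap(1)[OF r(1)] by simp
    have "g (X k j) = rho (min (X k (j + p - n) + d k) a)" unfolding eq by (rule kap(2)[OF r(1)])
    then show "a \<le> g (X k j)" "g (X k j) \<le> B" "g (g (X k j)) = min (X k (j + p - n) + d k) a"
      using r by auto
  qed
  have anti: "g (X k j) \<le> g (X k i)" if ij: "n - p \<le> i" "i \<le> j" "j < n" for i j k
  proof -
    have m: "i + p - n < n" "j + p - n < n" using ij pn by auto
    have eq: "g (X k l) = rho (min (X k (l + p - n) + d k) a)" if "n - p \<le> l" "l < n" for l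
    proof -
      have "l + p - n < n" using that pn by simp
      moreover have "X k l = kap (rho (min (X k (l + p - n) + d k) a))"
        using Xfix[of l k] that by (simp add: pullback_def)
      ultimately show ?thesis using kap(2)[OF rho(1)[OF varg]] by simp
    qed
    have "min (X k (i + p - n) + d k) a \<le> min (X k (j + p - n) + d k) a"
      using Xmono[of "i + p - n" "j + p - n" k] ij m by (intro min.mono) auto
    then show ?thesis using eq[of i] eq[of j] ij rho_antimono[OF varg[OF m(1)] varg[OF m(2)]] by simp
  qed
  have XAB: "X k j \<in> {A..B}" if "j < n" for k j using XA[OF that, of k] a_less_B by auto
  have g1: "(\<lambda>k. g (X k j)) \<longlonglongrightarrow> g (x j)" if "j < n" for j
    using glim[OF lim[OF that]] XAB[OF that] by blast
  have g2: "(\<lambda>k. g (g (X k j))) \<longlonglongrightarrow> g (g (x j))" if "n - p \<le> j" "j < n" for j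
  proof (rule glim[OF g1[OF that(2)]])
    show "g (X k j) \<in> {A..B}" for k using high(2,3)[OF that, of k] A_le_c c_less_a by simp
  qed
  have xV: "x \<in> ?V"
    unfolding monotone_vectors_def
  proof (intro CollectI conjI allI impI)
    show "A \<le> x j" "x j \<le> a" if "j < n" for j
      using LIMSEQ_le_const[OF lim[OF that]] LIMSEQ_le_const2[OF lim[OF that]] XA[OF that] by blast+
    show "x i \<le> x j" if "i \<le> j" "j < n" for i j
      using that by (intro LIMSEQ_le[OF lim lim]) (auto intro: Xmono)
  qed
  have "gamma_orbit g a n p x"
  proof (rule gamma_orbit_of_weak[OF pn xV])
    show "x j \<le> c" if "j < n - p" for j
      using LIMSEQ_le_const2[OF lim[of j]] low(1) that by (metis add_lessD1 less_diff_conv)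
    show "g (x j) = x (j + p)" if "j < n - p" for j
      using LIMSEQ_unique[OF g1[of j]] vlim[of "j + p"] low(2)[OF that] that by simp
    show "c \<le> x j" if "n - p \<le> j" "j < n" for j
      using LIMSEQ_le_const[OF lim[of j]] high(1)[OF that] that by blast
    show "a \<le> g (x j)" if "n - p \<le> j" "j < n" for j
      using LIMSEQ_le_const[OF g1[of j]] high(2)[OF that] that by blast
    show "g (g (x j)) = x (j + p - n)" if "n - p \<le> j" "j < n" for j
      using LIMSEQ_unique[OF g2[OF that]] vlim[of "j + p - n"] high(4)[OF that] that pn by simp
    show "g (x j) \<le> g (x i)" if "n - p \<le> i" "i \<le> j" "j < n" for i j
      using that by (intro LIMSEQ_le[OF g1 g1]) (auto intro: anti)
  qed
  moreover have "A \<le> x j" if "j < n" for j using xV that by (simp add: monotone_vectors_def)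
  moreover have "c \<le> x j" "g (x j) \<le> B" if "n - p \<le> j" "j < n" for j
    using LIMSEQ_le_const[OF lim[of j]] high(1)[OF that] LIMSEQ_le_const2[OF g1[of j]] high(3)[OF that] that
    by blast+
  ultimately show "\<exists>x. gamma_orbit g a n p x \<and> (\<forall>j<n. A \<le> x j) \<and> (\<forall>j. n - p \<le> j \<longrightarrow> j < n \<longrightarrow> c \<le> x j \<and> g (x j) \<le> B)"
    by blast
qed

end

section \<open>Over-rotation numbers of patterns\<close>

abbreviation forward_orbit :: "(real \<Rightarrow> real) \<Rightarrow> real \<Rightarrow> real set" where
  "forward_orbit f y \<equiv> range (\<lambda>i. (f ^^ i) y)"

lemma periodic_orbit_bij:
  assumes "0 < k" "(f ^^ k) y = y"
  shows "bij_betw (\<lambda>i. (f ^^ i) y) {..<least_power f y} (forward_orbit f y)"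
proof -
  let ?N = "least_power f y"
  have N: "(f ^^ ?N) y = y" "0 < ?N" using least_powerI[OF assms(2,1)] by auto
  have mod: "(f ^^ i) y = (f ^^ (i mod ?N)) y" for i
    using funpow_mod_eq[OF N(1), of i] by simp
  have "inj_on (\<lambda>i. (f ^^ i) y) {..<?N}"
  proof (rule linorder_inj_onI)
    fix i j assume ij: "i < j" "i \<in> {..<?N}" "j \<in> {..<?N}"
    show "(f ^^ i) y \<noteq> (f ^^ j) y"
    proof
      assume eq: "(f ^^ i) y = (f ^^ j) y"
      have "(f ^^ (?N - j + i)) y = (f ^^ (?N - j)) ((f ^^ i) y)" by (simp add: funpow_add)
      also have "\<dots> = (f ^^ (?N - j + j)) y" unfolding eq by (simp add: funpow_add)
      also have "\<dots> = y" using ij N by simp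
      finally have "?N \<le> ?N - j + i" by (intro least_power_le) (use ij in auto)
      with ij show False by auto
    qed
  qed auto
  moreover have "(\<lambda>i. (f ^^ i) y) ` {..<?N} = forward_orbit f y"
  proof (intro equalityI subsetI)
    fix z assume "z \<in> forward_orbit f y"
    then obtain i where "z = (f ^^ i) y" by blast
    then have "z = (f ^^ (i mod ?N)) y" using mod by simp
    moreover have "i mod ?N < ?N" using N by simp
    ultimately show "z \<in> (\<lambda>i. (f ^^ i) y) ` {..<?N}" by blast
  qed auto
  ultimately show ?thesis by (simp add: bij_betw_def)
qed

lemma over_rotation_number_orbit:
  assumes "0 < k" "(f ^^ k) y = y"
  shows "over_rotation_number f y
    = (\<Sum>x\<in>forward_orbit f y. chi f x) / real (card (forward_orbit f y))"
  using sum.reindex_bij_betw[OF periodic_orbit_bij[OF assms], of "chi f"]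
    bij_betw_same_card[OF periodic_orbit_bij[OF assms]]
  by (simp add: over_rotation_number_def)

lemma finite_forward_orbit:
  assumes "0 < k" "(f ^^ k) y = y"
  shows "finite (forward_orbit f y)"
  using bij_betw_finite[OF periodic_orbit_bij[OF assms]] by simp

lemma forward_orbit_bij:
  assumes "0 < k" "(f ^^ k) y = y"
  shows "bij_betw f (forward_orbit f y) (forward_orbit f y)"
proof -
  have "f ` forward_orbit f y = forward_orbit f y"
  proof (intro equalityI subsetI)
    fix z assume "z \<in> f ` forward_orbit f y"
    then obtain i where "z = (f ^^ Suc i) y" by auto
    then show "z \<in> forward_orbit f y" by blast
  next
    fix z assume "z \<in> forward_orbit f y"
    then obtain i where i: "z = (f ^^ i) y" by blast
    have "z = (f ^^ (i + k)) y" using i assms by (simp add: funpow_add)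
    also have "\<dots> = f ((f ^^ (i + k - 1)) y)" using assms(1) by (cases "i + k") auto
    finally show "z \<in> f ` forward_orbit f y" by blast
  qed
  then show ?thesis
    using finite_forward_orbit[OF assms] by (simp add: bij_betw_def eq_card_imp_inj_on)
qed

lemma over_rotation_number_sided:
  assumes "0 < k" "(f ^^ k) y = y" "sided_cycle f a (forward_orbit f y)"
  shows "over_rotation_number f y
    = real (card (right_part a (forward_orbit f y))) / real (card (forward_orbit f y))"
  unfolding over_rotation_number_orbit[OF assms(1,2)] sided_cycle_chi_sum[OF assms(3)] ..

lemma exhibits_onE:
  assumes "exhibits_on f lo hi P \<pi>"
  obtains n h where "pattern n \<pi>" "strict_mono_on {1..n} h" "h ` {1..n} = P"
    "\<And>i. i \<in> {1..n} \<Longrightarrow> f (h i) = h (\<pi> i)" "\<And>i. i \<in> {1..n} \<Longrightarrow> \<pi> i \<in> {1..n}"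
    "P \<subseteq> {lo..hi}" "0 < n"
proof -
  obtain n h where 1: "pattern n \<pi>" "strict_mono_on {1..n} h" "h ` {1..n} = P"
    "\<And>i. i \<in> {1..n} \<Longrightarrow> f (h i) = h (\<pi> i)" "P \<subseteq> {lo..hi}"
    using assms by (auto simp: exhibits_on_def)
  moreover have "\<pi> i \<in> {1..n}" if "i \<in> {1..n}" for i
    using 1(1) that permutes_in_image unfolding pattern_def by metis
  moreover have "0 < n"
    using 1(1) by (cases n) (auto simp: pattern_def cyclic_on_def)
  ultimately show ?thesis using that by blast
qed

lemma exhibits_on_periodic:
  assumes ex: "exhibits_on f lo hi P \<pi>" and y: "y \<in> P"
  shows "P = forward_orbit f y" "\<exists>k>0. (f ^^ k) y = y"
proof -
  obtain n h where h: "pattern n \<pi>" "strict_mono_on {1..n} h" "h ` {1..n} = P"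
    "\<And>i. i \<in> {1..n} \<Longrightarrow> f (h i) = h (\<pi> i)" "\<And>i. i \<in> {1..n} \<Longrightarrow> \<pi> i \<in> {1..n}"
    using exhibits_onE[OF ex] by metis
  obtain i where i: "i \<in> {1..n}" "y = h i" using y h(3) by blast
  have orb: "orbit \<pi> i = {1..n}" using h(1) i by (auto simp: pattern_def cyclic_on_alldef)
  have pow: "(f ^^ k) (h i) = h ((\<pi> ^^ k) i) \<and> (\<pi> ^^ k) i \<in> {1..n}" for k
    by (induction k) (use i h(4,5) in auto)
  show "P = forward_orbit f y"
  proof (intro equalityI subsetI)
    fix z assume "z \<in> P"
    then obtain j where j: "j \<in> {1..n}" "z = h j" using h(3) by blast
    then have "j \<in> orbit \<pi> i" using orb by simp
    then obtain k where "j = (\<pi> ^^ k) i" unfolding orbit_altdef by blast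
    then have "z = (f ^^ k) y" using pow i j by simp
    then show "z \<in> forward_orbit f y" by blast
  next
    fix z assume "z \<in> forward_orbit f y"
    then obtain k where "z = (f ^^ k) y" by blast
    then show "z \<in> P" using pow[of k] i h(3) by blast
  qed
  have "i \<in> orbit \<pi> i" using orb i by simp
  then obtain k where "0 < k" "i = (\<pi> ^^ k) i" unfolding orbit_altdef by blast
  then have "(f ^^ k) y = y" using pow[of k] i by simp
  with \<open>0 < k\<close> show "\<exists>k>0. (f ^^ k) y = y" by blast
qed

lemma pattern_period_unique:
  assumes "pattern n \<pi>" "pattern m \<pi>"
  shows "n = m"
proof -
  have no: False if "pattern n \<pi>" "pattern m \<pi>" "n < m" for n m
  proof -
    have "\<pi> m = m" using that(1,3) by (auto simp: pattern_def permutes_def)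
    moreover have "orbit \<pi> m = {1..m}" using that by (auto simp: pattern_def cyclic_on_alldef)
    ultimately have "{1..m} = {m}" using orbit_eq_singleton_iff[of \<pi> m] by simp
    then have "m = 1" using that(3) by (metis atLeastAtMost_singleton_iff)
    then have "n = 0" using that by simp
    then show False using that(1) by (auto simp: pattern_def cyclic_on_def)
  qed
  show ?thesis using no[OF assms] no[OF assms(2,1)] by (meson linorder_neqE_nat)
qed

text \<open>
  The index of a point is the number of points of the set up to it.
\<close>
lemma strict_mono_enumeration_unique:
  fixes h h' :: "nat \<Rightarrow> real"
  assumes "strict_mono_on {1..n} h" "strict_mono_on {1..n} h'" "h ` {1..n} = h' ` {1..n}"
    and i: "i \<in> {1..n}"
  shows "h i = h' i"
proof -
  have card: "card {x \<in> k ` {1..n}. x \<le> k i} = i" if "strict_mono_on {1..n} k" "i \<in> {1..n}"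
    for k :: "nat \<Rightarrow> real" and i
  proof -
    have "{x \<in> k ` {1..n}. x \<le> k i} = k ` {1..i}"
      using that by (auto simp: strict_mono_on_less_eq)
    moreover have "inj_on k {1..i}"
      using inj_on_subset[OF strict_mono_on_imp_inj_on[OF that(1)], of "{1..i}"] that(2) by auto
    ultimately show ?thesis by (simp add: card_image)
  qed
  obtain j where j: "j \<in> {1..n}" "h i = h' j" using assms(3) i by blast
  have "i = card {x \<in> h ` {1..n}. x \<le> h i}" using card[OF assms(1) i] by simp
  also have "\<dots> = card {x \<in> h' ` {1..n}. x \<le> h' j}" using assms(3) j by simp
  also have "\<dots> = j" using card[OF assms(2) j(1)] .
  finally show ?thesis using j by simp
qed

lemma exhibits_on_unique:
  assumes "exhibits_on f lo hi P \<pi>" "exhibits_on f lo' hi' P \<theta>"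
  shows "\<pi> = \<theta>"
proof -
  obtain n h where h: "pattern n \<pi>" "strict_mono_on {1..n} h" "h ` {1..n} = P"
    "\<And>i. i \<in> {1..n} \<Longrightarrow> f (h i) = h (\<pi> i)" "\<And>i. i \<in> {1..n} \<Longrightarrow> \<pi> i \<in> {1..n}"
    using exhibits_onE[OF assms(1)] by metis
  obtain m k where k: "pattern m \<theta>" "strict_mono_on {1..m} k" "k ` {1..m} = P"
    "\<And>i. i \<in> {1..m} \<Longrightarrow> f (k i) = k (\<theta> i)" "\<And>i. i \<in> {1..m} \<Longrightarrow> \<theta> i \<in> {1..m}"
    using exhibits_onE[OF assms(2)] by metis
  have injh: "inj_on h {1..n}" using strict_mono_on_imp_inj_on[OF h(2)] .
  have injk: "inj_on k {1..m}" using strict_mono_on_imp_inj_on[OF k(2)] .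
  have nm: "n = m" using card_image[OF injh] card_image[OF injk] h(3) k(3) by simp
  have hk: "h i = k i" if "i \<in> {1..n}" for i
    using strict_mono_enumeration_unique[OF h(2), of k] k(2,3) h(3) nm that by simp
  show ?thesis
  proof
    fix i
    show "\<pi> i = \<theta> i"
    proof (cases "i \<in> {1..n}")
      case True
      then have "h (\<pi> i) = h (\<theta> i)"
        using h(4)[OF True] k(4)[of i] hk[OF True] hk[of "\<theta> i"] k(5)[of i] nm by simp
      then show ?thesis using injh h(5)[OF True] k(5)[of i] nm True by (auto dest: inj_onD)
    next
      case False
      then show ?thesis using h(1) k(1) nm by (simp add: pattern_def permutes_def)
    qed
  qed
qed

text \<open>
  The value \<open>chi f (h i)\<close> depends only on the order of \<open>h i\<close>, \<open>h (\<pi> i)\<close> and \<open>h (\<pi> (\<pi> i))\<close>.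
\<close>
lemma over_rotation_number_pattern:
  assumes "exhibits_on f lo hi P \<pi>" "y \<in> P" "exhibits_on f' lo' hi' P' \<pi>" "y' \<in> P'"
  shows "over_rotation_number f y = over_rotation_number f' y'"
proof -
  obtain n h where h: "pattern n \<pi>" "strict_mono_on {1..n} h" "h ` {1..n} = P"
    "\<And>i. i \<in> {1..n} \<Longrightarrow> f (h i) = h (\<pi> i)" "\<And>i. i \<in> {1..n} \<Longrightarrow> \<pi> i \<in> {1..n}"
    using exhibits_onE[OF assms(1)] by metis
  obtain m k where k: "pattern m \<pi>" "strict_mono_on {1..m} k" "k ` {1..m} = P'"
    "\<And>i. i \<in> {1..m} \<Longrightarrow> f' (k i) = k (\<pi> i)"
    using exhibits_onE[OF assms(3)] by metis
  have nm: "m = n" using pattern_period_unique[OF k(1) h(1)] .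
  have sgn: "(h i - h j \<le> 0) = (k i - k j \<le> 0)" "(0 \<le> h i - h j) = (0 \<le> k i - k j)"
    if "i \<in> {1..n}" "j \<in> {1..n}" for i j
    using strict_mono_on_less_eq[OF h(2), of i j] strict_mono_on_less_eq[OF k(2), of i j]
      strict_mono_on_less_eq[OF h(2), of j i] strict_mono_on_less_eq[OF k(2), of j i] that nm by auto
  have chi: "chi f (h i) = chi f' (k i)" if i: "i \<in> {1..n}" for i
  proof -
    have *: "f (h i) = h (\<pi> i)" "f (h (\<pi> i)) = h (\<pi> (\<pi> i))"
      "f' (k i) = k (\<pi> i)" "f' (k (\<pi> i)) = k (\<pi> (\<pi> i))"
      using h(4,5) k(4) nm i by auto
    show ?thesis
      using sgn[OF h(5)[OF i] i] sgn[OF h(5)[OF h(5)[OF i]] h(5)[OF i]]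
      unfolding chi_def * mult_le_0_iff by simp
  qed
  have "(\<Sum>x\<in>P. chi f x) = (\<Sum>i\<in>{1..n}. chi f (h i))"
    unfolding h(3)[symmetric] using strict_mono_on_imp_inj_on[OF h(2)] by (simp add: sum.reindex)
  also have "\<dots> = (\<Sum>i\<in>{1..n}. chi f' (k i))" using chi by (rule sum.cong[OF refl])
  also have "\<dots> = (\<Sum>x\<in>P'. chi f' x)"
    unfolding k(3)[symmetric] using strict_mono_on_imp_inj_on[OF k(2)] nm by (simp add: sum.reindex)
  finally have sums: "(\<Sum>x\<in>P. chi f x) = (\<Sum>x\<in>P'. chi f' x)" .
  have "card P = n" "card P' = n"
    using card_image[OF strict_mono_on_imp_inj_on[OF h(2)]] card_image[OF strict_mono_on_imp_inj_on[OF k(2)]]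
      h(3) k(3) nm by auto
  moreover obtain k1 k2 where "0 < k1" "(f ^^ k1) y = y" "0 < k2" "(f' ^^ k2) y' = y'"
    using exhibits_on_periodic(2)[OF assms(1,2)] exhibits_on_periodic(2)[OF assms(3,4)] by blast
  ultimately show ?thesis
    using over_rotation_number_orbit[of k1 f y] over_rotation_number_orbit[of k2 f' y'] sums
    unfolding exhibits_on_periodic(1)[OF assms(1,2), symmetric] exhibits_on_periodic(1)[OF assms(3,4), symmetric]
    by simp
qed

lemma pattern_over_rotation_number_eq:
  assumes "interval_map f lo hi" "exhibits_on f lo hi P \<pi>" "y \<in> P"
  shows "pattern_over_rotation_number \<pi> = over_rotation_number f y"
  unfolding pattern_over_rotation_number_def
proof (rule the_equality)
  show "\<exists>g a b Q z. interval_map g a b \<and> exhibits_on g a b Q \<pi> \<and> z \<in> Q \<and>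
          over_rotation_number f y = over_rotation_number g z"
    using assms by blast
  show "r = over_rotation_number f y"
    if "\<exists>g a b Q z. interval_map g a b \<and> exhibits_on g a b Q \<pi> \<and> z \<in> Q \<and> r = over_rotation_number g z"
    for r
    using that over_rotation_number_pattern[OF _ _ assms(2,3)] by metis
qed

lemma exhibits_on_bij:
  assumes "exhibits_on f lo hi P \<pi>"
  shows "finite P" "P \<noteq> {}" "bij_betw f P P"
proof -
  obtain n and h :: "nat \<Rightarrow> real" where h: "h ` {1..n} = P" "0 < n"
    by (rule exhibits_onE[OF assms]) (rule that)
  then obtain y where y: "y \<in> P" by force
  show "finite P" "P \<noteq> {}" using h y by auto
  obtain k where "0 < k" "(f ^^ k) y = y" using exhibits_on_periodic(2)[OF assms y] by blast
  then have "bij_betw f (forward_orbit f y) (forward_orbit f y)" by (rule forward_orbit_bij)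
  then show "bij_betw f P P" by (simp only: exhibits_on_periodic(1)[OF assms y, symmetric])
qed

lemma exhibits_on_sided_over_rotation:
  assumes "exhibits_on f lo hi P \<pi>" "y \<in> P" "sided_cycle f a P"
  shows "over_rotation_number f y = real (card (right_part a P)) / real (card P)"
proof -
  obtain k where "0 < k" "(f ^^ k) y = y" using exhibits_on_periodic(2)[OF assms(1,2)] by blast
  then show ?thesis
    using over_rotation_number_sided[of k f y a] assms(3)
    unfolding exhibits_on_periodic(1)[OF assms(1,2), symmetric] by blast
qed

text \<open>
  Between its points number \<open>n\<close> and \<open>n + 1\<close> every cycle of this pattern is split like a cycle of a unimodal map, and \<open>p\<close> points
  are on the right. This determines the over-rotation number.
\<close>
lemma gamma_pattern_sided:
  assumes p: "0 < p" "p \<le> n" "coprime p n"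
    and ex: "exhibits_on f lo hi P (gamma_pattern p (n + p))"
  obtains a where "sided_cycle f a P" "card (right_part a P) = p" "card P = n + p"
proof -
  obtain m h where h: "pattern m (gamma_pattern p (n + p))" "strict_mono_on {1..m} h" "h ` {1..m} = P"
    "\<And>i. i \<in> {1..m} \<Longrightarrow> f (h i) = h (gamma_pattern p (n + p) i)"
    using exhibits_onE[OF ex] by metis
  have m: "m = n + p" using pattern_period_unique[OF h(1) gamma_pattern_pattern[OF p]] .
  note less = strict_mono_on_less[OF h(2)]
  define a where "a = (h n + h (n + 1)) / 2"
  have nn: "h n < h (n + 1)" using less[of n "n + 1"] p m by simp
  have left: "h i < a \<longleftrightarrow> i \<le> n" and right: "a < h i \<longleftrightarrow> n < i" if "i \<in> {1..m}" for i
  proof -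
    have "h i \<le> h n" if "i \<le> n"
      using strict_mono_on_less_eq[OF h(2), of i n] that \<open>i \<in> {1..m}\<close> m by simp
    moreover have "h (n + 1) \<le> h i" if "n < i"
      using strict_mono_on_less_eq[OF h(2), of "n + 1" i] that \<open>i \<in> {1..m}\<close> m by simp
    ultimately show "h i < a \<longleftrightarrow> i \<le> n" "a < h i \<longleftrightarrow> n < i"
      using nn unfolding a_def by (cases "i \<le> n"; force)+
  qed
  have "sided_cycle f a P"
    unfolding sided_cycle_def
  proof (intro conjI ballI exhibits_on_bij[OF ex])
    fix y assume "y \<in> P"
    then obtain i where i: "i \<in> {1..m}" "y = h i" using h(3) by blast
    have gi: "gamma_pattern p (n + p) i \<in> {1..m}"
      using h(1) i(1) permutes_in_image unfolding pattern_def by metis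
    show "y < a \<and> y < f y \<or> a < y \<and> f y < a"
    proof (cases "i \<le> n")
      case True
      then have "i < gamma_pattern p (n + p) i" using i m p by (auto simp: gamma_pattern_nat)
      then show ?thesis using True i h(4)[OF i(1)] left[OF i(1)] less[OF i(1) gi] by simp
    next
      case False
      then have "gamma_pattern p (n + p) i \<le> n" using i m p by (auto simp: gamma_pattern_nat)
      then show ?thesis using False i h(4)[OF i(1)] right[OF i(1)] left[OF gi] by simp
    qed
  qed
  moreover have inj: "inj_on h {1..m}" using strict_mono_on_imp_inj_on[OF h(2)] .
  have "right_part a P = h ` {n + 1..m}"
    using right h(3) by (auto simp: m)
  then have "card (right_part a P) = p"
    using card_image[OF inj_on_subset[OF inj], of "{n + 1..m}"] m by simp
  moreover have "card P = n + p" using card_image[OF inj] h(3) m by simp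
  ultimately show ?thesis using that by blast
qed

lemma gamma_pattern_over_rotation:
  assumes "0 < p" "p \<le> n" "coprime p n"
    and ex: "exhibits_on f lo hi P (gamma_pattern p (n + p))" and y: "y \<in> P"
  shows "over_rotation_number f y = real p / real (n + p)" "f y \<noteq> y"
proof -
  obtain a where a: "sided_cycle f a P" "card (right_part a P) = p" "card P = n + p"
    by (rule gamma_pattern_sided[OF assms(1-4)])
  show "over_rotation_number f y = real p / real (n + p)"
    using exhibits_on_sided_over_rotation[OF ex y a(1)] a(2,3) by simp
  show "f y \<noteq> y" using a(1) y unfolding sided_cycle_def by fastforce
qed

section \<open>Unimodal maps\<close>

lemma two_cycle_exhibits:
  assumes x: "x \<in> {lo..hi}" "g x \<in> {lo..hi}" "g x \<noteq> x" "g (g x) = x"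
  shows "exhibits_on g lo hi {x, g x} (gamma_pattern 1 2)"
proof -
  define u where "u = min x (g x)"
  have u: "u < g u" "g (g u) = u" "u \<in> {lo..hi}" "g u \<in> {lo..hi}"
    using x by (auto simp: u_def min_def)
  have orb: "gamma_orbit g ((u + g u) / 2) 1 1 (\<lambda>_. u)"
    using u by (auto simp: gamma_orbit_def)
  have sub: "(\<lambda>_. u) ` {..<1::nat} \<union> g ` (\<lambda>_. u) ` {1 - 1..<1::nat} \<subseteq> {lo..hi}" using u by auto
  have "exhibits_on g lo hi ((\<lambda>_. u) ` {..<1::nat} \<union> g ` (\<lambda>_. u) ` {1 - 1..<1::nat}) (gamma_pattern 1 (1 + 1))"
    by (rule gamma_orbit_exhibits[OF _ _ _ orb sub]) simp_all
  moreover have "(\<lambda>_. u) ` {..<1::nat} \<union> g ` (\<lambda>_. u) ` {1 - 1..<1::nat} = {x, g x}"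
    using x(4) by (auto simp: u_def min_def)
  ultimately show ?thesis unfolding one_add_one by simp
qed

text \<open>
  The intermediate value theorem for \<open>g \<circ> g\<close>, which maps \<open>c\<close> to \<open>A \<le> c\<close>. To obtain a point that
  is not fixed by \<open>g\<close>, one starts to the right of the last fixed point \<open>e\<close> in \<open>{A..c}\<close>: between \<open>e\<close> and \<open>c\<close> the map \<open>g\<close>
  takes the value \<open>a\<close> at some \<open>e'\<close>, and \<open>g (g e') = a > e'\<close>. If there is no fixed point, \<open>A\<close> can be used in place of \<open>e'\<close>.
\<close>
lemma (in folded) period_two:
  assumes g: "interval_map g lo hi" and sub: "{A..B} \<subseteq> {lo..hi}" and A: "A \<le> g (g A)"
  shows "\<exists>P. exhibits_on g lo hi P (gamma_pattern 1 2)"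
proof -
  have AB: "A \<le> c" "c < a" "a < B" using A_le_c c_less_a a_less_B by auto
  have contg: "continuous_on {lo..hi} g" and img: "g ` {lo..hi} \<subseteq> {lo..hi}"
    using g by (auto simp: interval_map_def)
  have cont2: "continuous_on {A..c} (\<lambda>x. g (g x) - x)"
  proof (intro continuous_intros)
    have "{A..c} \<subseteq> {lo..hi}" using sub AB by force
    then show "continuous_on {A..c} (\<lambda>x. g (g x))"
      using img by (intro continuous_on_compose2[OF contg] continuous_on_subset[OF contg]) auto
  qed
  have cont1: "continuous_on {A..c} (\<lambda>x. g x - x)"
    using AB by (intro continuous_intros continuous_on_subset[OF cont]) auto
  have zero: "\<exists>x. e \<le> x \<and> x \<le> c \<and> g (g x) = x" if e: "A \<le> e" "e \<le> c" "e \<le> g (g e)" for e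
  proof -
    have "\<exists>x\<ge>e. x \<le> c \<and> g (g x) - x = 0"
      using e g_c g_B AB continuous_on_subset[OF cont2, of "{e..c}"]
      by (intro IVT2') auto
    then show ?thesis by auto
  qed
  have "\<exists>x. A \<le> x \<and> x \<le> c \<and> g (g x) = x \<and> g x \<noteq> x"
  proof (cases "\<exists>e\<in>{A..c}. g e = e")
    case False
    with zero[of A] A AB show ?thesis by auto
  next
    case True
    then obtain e0 where e0: "e0 \<in> {A..c}" "g e0 - e0 \<le> 0" by force
    define e where "e = Sup {y \<in> {A..c}. g y - y \<le> 0}"
    have "0 \<le> g c - c" using g_c AB by simp
    note e = last_exit[OF cont1 e0 this, folded e_def]
    have ec: "e < c" using e(1,2) g_c AB by (cases "e = c") auto
    have up: "x < g x" if "e < x" "x \<le> c" for x using e(1) e(4)[of x] that by force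
    have "\<exists>x\<ge>e. x \<le> c \<and> g x = a"
      using e(1,2) ec AB g_c by (intro IVT' continuous_on_subset[OF cont]) auto
    then obtain e' where e': "e \<le> e'" "e' \<le> c" "g e' = a" by blast
    have "e' \<noteq> e" using e' e(2) ec AB by auto
    with e' have "e < e'" by simp
    have "\<exists>x. e' \<le> x \<and> x \<le> c \<and> g (g x) = x"
      using e' e(1) g_a AB by (intro zero) auto
    then obtain x where x: "e' \<le> x" "x \<le> c" "g (g x) = x" by blast
    with up[of x] \<open>e < e'\<close> e(1) show ?thesis by (intro exI[of _ x]) auto
  qed
  then obtain x where x: "A \<le> x" "x \<le> c" "g (g x) = x" "g x \<noteq> x" by blast
  then have "x \<in> {lo..hi}" using sub AB by auto
  with img x two_cycle_exhibits[of x lo hi g] show ?thesis by blast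
qed

lemma (in folded) gamma_orbit_exhibits_within:
  assumes "0 < p" "p \<le> n" "coprime p n" and orb: "gamma_orbit g a n p x"
    and low: "\<And>j. j < n \<Longrightarrow> A \<le> x j" and high: "\<And>j. n - p \<le> j \<Longrightarrow> j < n \<Longrightarrow> g (x j) \<le> B"
    and sub: "{A..B} \<subseteq> {lo..hi}"
  shows "\<exists>P. exhibits_on g lo hi P (gamma_pattern p (n + p))"
proof -
  have "x j < a" if "j < n" for j using orb that by (simp add: gamma_orbit_def)
  then have "x ` {..<n} \<subseteq> {A..B}" using low a_less_B by (force intro: less_imp_le)
  moreover have "a < g (x j)" if "n - p \<le> j" "j < n" for j
    using orb that by (simp add: gamma_orbit_def)
  then have "g ` x ` {n - p..<n} \<subseteq> {A..B}"
    using high A_le_c c_less_a by (force intro: less_imp_le)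
  ultimately have "x ` {..<n} \<union> g ` x ` {n - p..<n} \<subseteq> {lo..hi}" using sub by blast
  from gamma_orbit_exhibits[OF assms(1-4) this] show ?thesis by blast
qed

lemma nonfixed_periodic_orbit:
  assumes "nonfixed_periodic f y" "z \<in> forward_orbit f y"
  shows "f z \<noteq> z"
proof
  assume fz: "f z = z"
  obtain k where k: "0 < k" "(f ^^ k) y = y" using assms(1) by (auto simp: nonfixed_periodic_def)
  obtain i where i: "z = (f ^^ i) y" using assms(2) by blast
  have "(f ^^ j) z = z" for j by (induction j) (use fz in auto)
  then have "z = (f ^^ (k * i - i + i)) y" using i by (simp add: funpow_add)
  also have "k * i - i + i = i * k" using k by (cases k) auto
  also have "(f ^^ (i * k)) y = y" by (induction i) (use k in \<open>auto simp: funpow_add\<close>)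
  finally have "f y = y" using fz by simp
  then show False using assms(1) by (simp add: nonfixed_periodic_def)
qed

text \<open>
  A unimodal map with its turning point \<open>c\<close> and its fixed point \<open>a\<close>.
\<close>
locale unimodal_folded = folded f 0 c a 1 for f c a +
  assumes imap: "interval_map f 0 1" and c_pos: "0 < c"
    and inc: "strict_mono_on {0..c} f" and dec: "strict_antimono_on {c..1} f"
    and no_fixed: "\<And>x. x \<in> {0..<c} \<Longrightarrow> f x \<noteq> x"
begin

lemma maps: "f x \<in> {0..1}" if "x \<in> {0..1}"
  using imap that unfolding interval_map_def by blast

lemma dec_less: "c \<le> x \<Longrightarrow> x < y \<Longrightarrow> y \<le> 1 \<Longrightarrow> f y < f x"
  using monotone_onD[OF dec, of x y] by auto

lemma inc_less: "0 \<le> x \<Longrightarrow> x < y \<Longrightarrow> y \<le> c \<Longrightarrow> f x < f y"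
  using strict_mono_onD[OF inc, of x y] by auto

lemma left_up: "x < f x" if "0 \<le> x" "x < a"
proof (cases "x < c")
  case True
  show ?thesis
  proof (rule ccontr)
    assume "\<not> x < f x"
    moreover have "continuous_on {x..c} (\<lambda>x. f x - x)"
      using that c_less_a a_less_B by (intro continuous_intros continuous_on_subset[OF cont]) auto
    ultimately have "\<exists>y\<ge>x. y \<le> c \<and> f y - y = 0"
      using True g_c c_less_a a_less_B by (intro IVT') auto
    then obtain y where y: "x \<le> y" "y \<le> c" "f y = y" by auto
    then have "y \<noteq> c" using g_c c_less_a a_less_B by auto
    with y no_fixed[of y] that show False by auto
  qed
next
  case False
  then show ?thesis using dec_less[of x a] that g_a a_less_B by simp
qed

lemma right_down: "f x < a" if "a < x" "x \<le> 1"
  using dec_less[of a x] that g_a c_less_a by simp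

text \<open>
  Hence all cycles of a unimodal map are subject to the alternative between a gamma orbit and a frequency gap.
\<close>
lemma cycle_admissible:
  assumes "y \<in> {0..1}" "nonfixed_periodic f y"
  shows "admissible (forward_orbit f y)"
proof -
  obtain k where k: "0 < k" "(f ^^ k) y = y" using assms by (auto simp: nonfixed_periodic_def)
  have mem: "(f ^^ i) y \<in> {0..1}" for i
  proof (induction i)
    case (Suc i)
    then show ?case using maps[of "(f ^^ i) y"] by simp
  qed (use assms in simp)
  show ?thesis
    unfolding admissible_def sided_cycle_def
  proof (intro conjI ballI impI finite_forward_orbit[OF k] forward_orbit_bij[OF k])
    show "forward_orbit f y \<subseteq> {0..1}" using mem by blast
  next
    fix z assume z: "z \<in> forward_orbit f y"
    then have "z \<in> {0..1}" using mem by blast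
    moreover have "z \<noteq> a" using nonfixed_periodic_orbit[OF assms(2) z] g_a by auto
    ultimately show "z < a \<and> z < f z \<or> a < z \<and> f z < a" using left_up[of z] right_down[of z]
      by (cases z a rule: linorder_cases) auto
  next
    fix z assume "z \<in> forward_orbit f y" "z < a" "f z < a"
    then show "z < c" using dec_less[of z a] g_a a_less_B by force
  qed
qed

lemma exhibits_two_cycle: "\<exists>P. exhibits_on f 0 1 P (gamma_pattern 1 2)"
  using period_two[OF imap] maps[of 0] maps[of "f 0"] by simp

text \<open>
  For \<open>p < n\<close>, a frequency gap with constant \<open>L\<close> would keep all over-rotation numbers above \<open>p / q\<close> by at
  least \<open>1 / (2 * L * q)\<close>, since at most half of the points of a cycle are on the right.
\<close>
lemma exhibits_gamma:
  assumes pq: "0 < p" "2 * p \<le> q" "coprime p q"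
    and low: "\<And>e. 0 < e \<Longrightarrow> \<exists>y\<in>{0..1}. nonfixed_periodic f y \<and>
      over_rotation_number f y < real p / real q + e"
  shows "\<exists>P. exhibits_on f 0 1 P (gamma_pattern p q)"
proof (cases "q = 2 * p")
  case True
  then have "p = 1" using pq by simp
  then show ?thesis using exhibits_two_cycle True by simp
next
  case False
  define n where "n = q - p"
  have n: "p < n" "q = n + p" using False pq by (auto simp: n_def)
  have cop: "coprime p n" using coprime_diff_right[OF pq(3)] pq(2) by (simp add: n_def)
  consider x where "gamma_orbit f a n p x" "\<And>j. j < n \<Longrightarrow> 0 \<le> x j"
      "\<And>j. n - p \<le> j \<Longrightarrow> j < n \<Longrightarrow> f (x j) \<le> 1"
    | L where "0 < L" "\<And>Q. admissible Q \<Longrightarrow> int (card (left_part a Q))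
       \<le> int L * (int n * int (card (right_part a Q)) - int p * int (card (left_part a Q)))"
    using gamma_orbit_or_gap[OF pq(1) n(1) cop] by blast
  then show ?thesis
  proof cases
    case 1
    show ?thesis
      using gamma_orbit_exhibits_within[OF pq(1) _ cop 1(1)] 1(2,3) n by auto
  next
    case 2
    define e where "e = 1 / (2 * real L * real (n + p))"
    have "0 < e" using 2(1) n by (simp add: e_def)
    then obtain y where y: "y \<in> {0..1}" "nonfixed_periodic f y"
      "over_rotation_number f y < real p / real q + e" using low by blast
    let ?Q = "forward_orbit f y"
    have adm: "admissible ?Q" by (rule cycle_admissible[OF y(1,2)])
    then have sQ: "sided_cycle f a ?Q" by (simp add: admissible_def)
    define m k where "m = card (left_part a ?Q)" and "k = card (right_part a ?Q)"
    have km: "k \<le> m" "card ?Q = m + k" using sided_cycle_card[OF sQ] by (auto simp: m_def k_def)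
    have "0 < m" using sided_cycle_parts_nonempty(1)[OF sQ] sided_cycleD(1)[OF sQ]
      by (auto simp: m_def card_gt_0_iff)
    obtain k0 where "0 < k0" "(f ^^ k0) y = y" using y(2) by (auto simp: nonfixed_periodic_def)
    then have orn: "over_rotation_number f y = real k / real (m + k)"
      using over_rotation_number_sided[OF _ _ sQ] km by (simp add: k_def)
    have "int m \<le> int L * (int n * int k - int p * int m)" using 2(2)[OF adm] by (simp add: m_def k_def)
    then have "real_of_int (int m) \<le> real_of_int (int L * (int n * int k - int p * int m))"
      by (simp only: of_int_le_iff)
    then have gap: "real m \<le> real L * (real n * real k - real p * real m)" by simp
    have "real p / real q + e \<le> real k / real (m + k)"
    proof -
      have "real (m + k) \<le> 2 * real m" using km by simp
      also have "\<dots> \<le> 2 * (real L * (real n * real k - real p * real m))" using gap by simp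
      finally have "real (m + k) \<le> 2 * real L * (real k * real (n + p) - real p * real (m + k))"
        by (simp add: algebra_simps)
      then have le: "(2 * real L * real p + 1) * real (m + k) \<le> real k * (2 * real L * real (n + p))"
        by (simp add: algebra_simps)
      have frac: "u / v \<le> w / z" if "u * z \<le> w * v" "0 < v" "0 < z" for u v w z :: real
        using that by (simp add: field_simps)
      have "0 < real q" "0 < real L" using 2(1) n by auto
      then have "real p / real q + e = (2 * real L * real p + 1) / (2 * real L * real (n + p))"
        unfolding e_def n(2)[symmetric] by (simp add: add_divide_distrib)
      also have "\<dots> \<le> real k / real (m + k)"
        using 2(1) \<open>0 < m\<close> n by (intro frac le) auto
      finally show ?thesis .
    qed
    with y(3) orn show ?thesis by simp
  qed
qed

end

lemma unimodal_map_folded: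
  assumes "unimodal_map f"
  obtains c a where "unimodal_folded f c a"
proof -
  obtain c where c: "interval_map f 0 1" "0 < c" "c < 1" "f c = 1" "f 1 = 0"
    "strict_mono_on {0..c} f" "strict_antimono_on {c..1} f" "\<And>x. x \<in> {0..<c} \<Longrightarrow> f x \<noteq> x"
    using assms unfolding unimodal_map_def by blast
  have cont: "continuous_on {0..1} f" using c(1) by (simp add: interval_map_def)
  have "\<exists>x\<ge>c. x \<le> 1 \<and> f x - x = 0"
    using c by (intro IVT2' continuous_intros continuous_on_subset[OF cont]) auto
  then obtain a where a: "c \<le> a" "a \<le> 1" "f a = a" by auto
  then have "c < a" "a < 1" using c by (cases "a = c"; cases "a = 1"; simp)+
  then have "unimodal_folded f c a"
    by unfold_locales (use c cont a in auto)
  then show ?thesis by (rule that)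
qed

text \<open>
  A unimodal map with a slow cycle: \<open>0, 1/N, \<dots>, 1\<close> is climbed by steps of \<open>1/N\<close>, and 1 is mapped to 0.
\<close>
definition climbing_tent :: "nat \<Rightarrow> real \<Rightarrow> real" where
  "climbing_tent N x = min (x + 1 / real N) (real N * (1 - x))"

lemma climbing_tent_unimodal:
  assumes N: "2 \<le> N"
  shows "unimodal_folded (climbing_tent N) (1 - 1 / real N) (real N / real (N + 1))"
    "unimodal_map (climbing_tent N)"
proof -
  let ?c = "1 - 1 / real N"
  have N2: "2 \<le> real N" using N by simp
  have left: "climbing_tent N x = x + 1 / real N" if "x \<le> ?c" for x
  proof -
    have "1 \<le> real N * (1 - x)"
      using mult_left_mono[of "1 / real N" "1 - x" "real N"] that N2 by simp
    moreover have "x + 1 / real N \<le> 1" using that by simp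
    ultimately show ?thesis by (simp add: climbing_tent_def)
  qed
  have right: "climbing_tent N x = real N * (1 - x)" if "?c \<le> x" for x
  proof -
    have "real N * (1 - x) \<le> 1"
      using mult_left_mono[of "1 - x" "1 / real N" "real N"] that N2 by simp
    moreover have "1 \<le> x + 1 / real N" using that by simp
    ultimately show ?thesis by (simp add: climbing_tent_def)
  qed
  have c: "0 < ?c" "?c < 1" using N2 by (auto simp: field_simps)
  have cont: "continuous_on {0..1} (climbing_tent N)"
    unfolding climbing_tent_def by (intro continuous_intros)
  have "climbing_tent N x \<in> {0..1}" if "x \<in> {0..1}" for x
  proof (cases "x \<le> ?c")
    case True
    then show ?thesis using left[OF True] that N2 by simp
  next
    case False
    have "real N * (1 - x) \<le> 1"
      using mult_left_mono[of "1 - x" "1 / real N" "real N"] False N2 by simp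
    then show ?thesis using right[of x] False that N2 by simp
  qed
  then have imap: "interval_map (climbing_tent N) 0 1" using cont by (auto simp: interval_map_def)
  have inc: "strict_mono_on {0..?c} (climbing_tent N)"
    by (intro strict_mono_onI) (simp add: left)
  have dec: "strict_antimono_on {?c..1} (climbing_tent N)"
    using N2 by (intro monotone_onI) (simp add: right)
  have peak: "climbing_tent N ?c = 1" "climbing_tent N 1 = 0"
    using left[of ?c] right[of 1] c N2 by auto
  have nofix: "climbing_tent N x \<noteq> x" if "x \<in> {0..<?c}" for x using left[of x] that N2 by simp
  show "unimodal_map (climbing_tent N)"
    unfolding unimodal_map_def using imap c peak inc dec nofix by blast
  have a: "?c < real N / real (N + 1)" "real N / real (N + 1) < 1" using N2 by (auto simp: field_simps)
  have "real N * (1 - real N / real (N + 1)) = real N / real (N + 1)" by (simp add: field_simps)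
  then have fa: "climbing_tent N (real N / real (N + 1)) = real N / real (N + 1)"
    using right[of "real N / real (N + 1)"] a by simp
  show "unimodal_folded (climbing_tent N) ?c (real N / real (N + 1))"
    by unfold_locales (use c a peak fa imap cont inc dec nofix in auto)
qed

text \<open>
  The slow cycle has one point on the right and \<open>n\<close> on the left. Its frequency \<open>1 / n \<le> p / n\<close> excludes a gap.
\<close>
lemma climbing_tent_gamma_orbit:
  assumes pn: "0 < p" "p < n" "coprime p n"
  defines "a \<equiv> real n / real (n + 1)"
  shows "\<exists>x. gamma_orbit (climbing_tent n) a n p x \<and> (\<forall>j<n. 0 \<le> x j) \<and>
    (\<forall>j. n - p \<le> j \<longrightarrow> j < n \<longrightarrow> 1 - 1 / real n \<le> x j \<and> climbing_tent n (x j) \<le> 1)"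
proof -
  let ?f = "climbing_tent n"
  have n2: "2 \<le> n" using pn by simp
  interpret unimodal_folded ?f "1 - 1 / real n" a unfolding a_def by (rule climbing_tent_unimodal(1)[OF n2])
  have step: "?f (real i / real n) = real (Suc i) / real n" if "i < n" for i
  proof -
    have "real (Suc i) / real n \<le> 1" using that by simp
    also have "1 \<le> real (n - i)" using that by simp
    also have "\<dots> = real n * (1 - real i / real n)" using that by (simp add: field_simps of_nat_diff)
    finally have "real (Suc i) / real n \<le> real n * (1 - real i / real n)" .
    then show ?thesis using that by (simp add: climbing_tent_def add_divide_distrib)
  qed
  have pow: "(?f ^^ i) 0 = real i / real n" if "i \<le> n" for i
    using that by (induction i) (auto simp: step)
  have per: "(?f ^^ Suc n) 0 = 0" using pow[of n] g_B n2 by simp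
  have "?f 0 \<noteq> 0" using step[of 0] n2 by simp
  with per have np: "nonfixed_periodic ?f 0" unfolding nonfixed_periodic_def by blast
  let ?Q = "forward_orbit ?f 0"
  have adm: "admissible ?Q" by (rule cycle_admissible[OF _ np]) simp
  then have sQ: "sided_cycle ?f a ?Q" by (simp add: admissible_def)
  have sub: "(?f ^^ i) 0 \<in> (\<lambda>i. real i / real n) ` {..n}" for i
  proof (induction i)
    case (Suc i)
    then obtain j where j: "j \<le> n" "(?f ^^ i) 0 = real j / real n" by auto
    show ?case
    proof (cases "j = n")
      case True
      then have "(?f ^^ Suc i) 0 = real 0 / real n" using j g_B n2 by simp
      then show ?thesis by blast
    next
      case False
      then have "(?f ^^ Suc i) 0 = real (Suc j) / real n" using j step[of j] by simp
      moreover have "Suc j \<in> {..n}" using False j by simp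
      ultimately show ?thesis by (simp only: image_eqI)
    qed
  qed force
  have small: "real i / real n < a" if "i < n" for i
  proof -
    have "real i / real n \<le> 1 - 1 / real n" using that by (simp add: field_simps)
    then show ?thesis using c_less_a by simp
  qed
  have "right_part a ?Q \<subseteq> {1}"
  proof
    fix z assume z: "z \<in> right_part a ?Q"
    then obtain j where "j \<le> n" "z = real j / real n" using sub by auto
    then show "z \<in> {1}" using small[of j] z n2 by (cases "j = n") auto
  qed
  then have right: "card (right_part a ?Q) \<le> 1" using card_mono[of "{1}"] by simp
  have "(\<lambda>i. real i / real n) ` {..<n} \<subseteq> left_part a ?Q"
  proof
    fix z assume "z \<in> (\<lambda>i. real i / real n) ` {..<n}"
    then obtain i where i: "i < n" "z = real i / real n" by auto
    then have "z = (?f ^^ i) 0" using pow by simp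
    then show "z \<in> left_part a ?Q" using small[OF i(1)] i by auto
  qed
  moreover have "inj_on (\<lambda>i. real i / real n) {..<n}" using n2 by (intro inj_onI) simp
  ultimately have left: "n \<le> card (left_part a ?Q)"
    using sided_cycleD(1)[OF sQ] by (metis (no_types, lifting) card_image card_lessThan card_mono finite_subset mem_Collect_eq subsetI)
  have "\<not> int (card (left_part a ?Q))
     \<le> int L * (int n * int (card (right_part a ?Q)) - int p * int (card (left_part a ?Q)))" for L
  proof -
    have "n * card (right_part a ?Q) \<le> p * card (left_part a ?Q)"
    proof -
      have "n * card (right_part a ?Q) \<le> n * 1" using right by (rule mult_le_mono2)
      also have "\<dots> \<le> p * card (left_part a ?Q)" using mult_le_mono[of 1 p, OF _ left] pn by simp
      finally show ?thesis .
    qed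
    then have "int n * int (card (right_part a ?Q)) - int p * int (card (left_part a ?Q)) \<le> 0"
      by (simp flip: of_nat_mult)
    then have "int L * (int n * int (card (right_part a ?Q)) - int p * int (card (left_part a ?Q))) \<le> 0"
      by (intro mult_nonneg_nonpos) auto
    moreover have "0 < int (card (left_part a ?Q))" using left n2 by simp
    ultimately show ?thesis by linarith
  qed
  with gamma_orbit_or_gap[OF pn] adm show ?thesis by blast
qed

section \<open>Unimodal patterns force the rotation pattern\<close>

lemma exhibits_on_card:
  assumes ex: "exhibits_on f lo hi Q \<theta>" and m: "pattern m \<theta>"
  shows "card Q = m"
proof -
  obtain n h where h: "pattern n \<theta>" "strict_mono_on {1..n} h" "h ` {1..n} = Q"
    using exhibits_onE[OF ex] by metis
  have "n = m" using pattern_period_unique[OF h(1) m] .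
  then show ?thesis using card_image[OF strict_mono_on_imp_inj_on[OF h(2)]] h(3) by simp
qed

lemma exhibits_on_no_fixed_point:
  assumes ex: "exhibits_on f lo hi Q \<theta>" and m: "pattern m \<theta>" "2 \<le> m" and y: "y \<in> Q"
  shows "f y \<noteq> y"
proof
  assume fy: "f y = y"
  have "(f ^^ i) y = y" for i by (induction i) (use fy in auto)
  then have "Q = {y}" using exhibits_on_periodic(1)[OF ex y] by simp
  with exhibits_on_card[OF ex m(1)] m(2) show False by simp
qed

lemma sided_rotation_ratio:
  assumes "real r / real (l + r) = real p / real (n + p)" "0 < p" "0 < l"
  shows "n * r = p * l"
proof -
  have "real r * real (n + p) = real p * real (l + r)"
    using assms by (simp add: frac_eq_eq)
  then have "real (n * r) = real (p * l)" by (simp add: algebra_simps)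
  then show ?thesis by (simp only: of_nat_eq_iff)
qed

context unimodal_folded begin

text \<open>
  The combinatorial trace of unimodality: \<open>k\<close> is the index of the point with the largest image, and \<open>z\<close> the number of points
  to the left of the fixed point. These data transfer the hypotheses of the alternative to any other map with the pattern.
\<close>
lemma pattern_shape:
  assumes ex: "exhibits_on f 0 1 P \<pi>" and m: "pattern m \<pi>" "2 \<le> m"
  obtains k z where "1 \<le> k" "k \<le> z" "z < m" "\<pi> k = m" "\<pi> m = 1"
    "\<And>i. 1 \<le> i \<Longrightarrow> i \<le> z \<Longrightarrow> i < \<pi> i"
    "\<And>i. z < i \<Longrightarrow> i \<le> m \<Longrightarrow> \<pi> i \<le> z"
    "\<And>i. 1 \<le> i \<Longrightarrow> i \<le> z \<Longrightarrow> \<pi> i \<le> z \<Longrightarrow> i < k"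
proof -
  obtain n h where h: "pattern n \<pi>" "strict_mono_on {1..n} h" "h ` {1..n} = P"
    "\<And>i. i \<in> {1..n} \<Longrightarrow> f (h i) = h (\<pi> i)" "\<And>i. i \<in> {1..n} \<Longrightarrow> \<pi> i \<in> {1..n}"
    using exhibits_onE[OF ex] by metis
  have nm: "n = m" using pattern_period_unique[OF h(1) m(1)] .
  note h = h[unfolded nm]
  have P01: "P \<subseteq> {0..1}" using ex by (auto simp: exhibits_on_def)
  have perm: "\<pi> permutes {1..m}" using m(1) by (simp add: pattern_def)
  obtain y where y: "y \<in> P" using exhibits_on_bij(2)[OF ex] by blast
  have "nonfixed_periodic f y"
    unfolding nonfixed_periodic_def
    using exhibits_on_periodic(2)[OF ex y] exhibits_on_no_fixed_point[OF ex m y] by blast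
  from cycle_admissible[OF _ this] have adm: "admissible P"
    using y P01 exhibits_on_periodic(1)[OF ex y] by auto
  then have sP: "sided_cycle f a P" by (simp add: admissible_def)
  have hP: "h i \<in> P" if "i \<in> {1..m}" for i using h(3) that by blast
  have h01: "0 \<le> h i" "h i \<le> 1" if "i \<in> {1..m}" for i using hP[OF that] P01 by auto
  note hle = strict_mono_on_less_eq[OF h(2)]
  note hless = strict_mono_on_less[OF h(2)]
  let ?S = "{i\<in>{1..m}. h i < a}"
  have "?S \<noteq> {}" using sided_cycle_parts_nonempty(1)[OF sP] y h(3) by force
  define z where "z = Max ?S"
  have zS: "z \<in> ?S" unfolding z_def using \<open>?S \<noteq> {}\<close> by (intro Max_in) auto
  have left: "h i < a \<longleftrightarrow> i \<le> z" if "i \<in> {1..m}" for i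
  proof
    show "i \<le> z" if "h i < a" using that \<open>i \<in> {1..m}\<close> unfolding z_def by (intro Max_ge) auto
    show "h i < a" if "i \<le> z" using hle[of i z] zS that \<open>i \<in> {1..m}\<close> by auto
  qed
  have right: "a < h i \<longleftrightarrow> z < i" if "i \<in> {1..m}" for i
    using left[OF that] sided_cycleD(5)[OF sP hP[OF that]] by auto
  have "z < m"
  proof -
    obtain r where "r \<in> P" "a < r" using sided_cycle_parts_nonempty(2)[OF sP] y by auto
    then obtain i where "i \<in> {1..m}" "a < h i" using h(3) by blast
    then show ?thesis using right[of i] by auto
  qed
  have up: "i < \<pi> i" if "1 \<le> i" "i \<le> z" for i
  proof -
    have i: "i \<in> {1..m}" using that \<open>z < m\<close> by auto
    then have "h i < h (\<pi> i)"
      using sided_cycleD(6)[OF sP hP[OF i]] left[OF i] that h(4)[OF i] by simp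
    then show ?thesis using hless[OF i h(5)[OF i]] by simp
  qed
  have down: "\<pi> i \<le> z" if "z < i" "i \<le> m" for i
  proof -
    have i: "i \<in> {1..m}" using that by auto
    then have "h (\<pi> i) < a"
      using sided_cycleD(7)[OF sP hP[OF i]] right[OF i] that h(4)[OF i] by simp
    then show ?thesis using left[OF h(5)[OF i]] by simp
  qed
  have mm: "m \<in> {1..m}" "1 \<in> {1..m}" using m(2) by auto
  obtain k where k: "k \<in> {1..m}" "\<pi> k = m"
    using permutes_image[OF perm] mm(1) by (metis imageE)
  have kz: "k \<le> z" using down[of k] k \<open>z < m\<close> by (cases "k \<le> z") auto
  obtain j where j: "j \<in> {1..m}" "\<pi> j = 1"
    using permutes_image[OF perm] mm(2) by (metis imageE)
  have "z < j" using up[of j] j by (cases "j \<le> z") auto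
  have "j = m"
  proof (rule ccontr)
    assume "j \<noteq> m"
    then have "h j < h m" using hless[OF j(1) mm(1)] j by simp
    then have "f (h m) < f (h j)"
      using dec_less[of "h j" "h m"] right[OF j(1)] \<open>z < j\<close> c_less_a h01[OF mm(1)] by simp
    then have "h (\<pi> m) < h 1" using h(4)[OF mm(1)] h(4)[OF j(1)] j by simp
    then show False using hless[OF h(5)[OF mm(1)] mm(2)] h(5)[OF mm(1)] by simp
  qed
  have "i < k" if "1 \<le> i" "i \<le> z" "\<pi> i \<le> z" for i
  proof (rule ccontr)
    assume "\<not> i < k"
    have i: "i \<in> {1..m}" using that \<open>z < m\<close> by auto
    have lt: "h i < a" "f (h i) < a" using left[OF i] left[OF h(5)[OF i]] h(4)[OF i] that by auto
    then have "h i < c" using adm hP[OF i] by (simp add: admissible_def)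
    moreover have "h k \<le> h i" using hle[OF k(1) i] \<open>\<not> i < k\<close> by simp
    ultimately have "f (h k) \<le> f (h i)"
      using inc_less[of "h k" "h i"] h01[OF k(1)] by (cases "h k = h i") auto
    moreover have "a < f (h k)" using h(4)[OF k(1)] k right[OF mm(1)] \<open>z < m\<close> by simp
    ultimately show False using lt by simp
  qed
  with k kz \<open>z < m\<close> j \<open>j = m\<close> up down show ?thesis by (intro that[of k z]) auto
qed

text \<open>
  In a map \<open>g\<close> with a cycle \<open>R\<close> of pattern \<open>\<pi>\<close>, the interval between the end points of \<open>R\<close>, the point number \<open>k\<close>, and a
  fixed point between the points number \<open>z\<close> and \<open>z + 1\<close> form a folded map for which \<open>R\<close> is admissible. The frequency of \<open>R\<close> is
  exactly \<open>p / n\<close>, so there is no gap.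
\<close>
lemma pattern_forces_gamma:
  assumes ex: "exhibits_on f 0 1 P \<pi>" and m: "pattern m \<pi>" "2 \<le> m"
    and pq: "0 < p" "2 * p \<le> q" "coprime p q"
    and orn: "pattern_over_rotation_number \<pi> = real p / real q"
  shows "forces \<pi> (gamma_pattern p q)"
  unfolding forces_def
proof (intro allI impI)
  fix g lo hi assume g: "interval_map g lo hi" and "exhibits g lo hi \<pi>"
  then obtain R where exR: "exhibits_on g lo hi R \<pi>" by (auto simp: exhibits_def)
  obtain k z where kz: "1 \<le> k" "k \<le> z" "z < m" "\<pi> k = m" "\<pi> m = 1"
    and up: "\<And>i. 1 \<le> i \<Longrightarrow> i \<le> z \<Longrightarrow> i < \<pi> i"
    and down: "\<And>i. z < i \<Longrightarrow> i \<le> m \<Longrightarrow> \<pi> i \<le> z"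
    and mid: "\<And>i. 1 \<le> i \<Longrightarrow> i \<le> z \<Longrightarrow> \<pi> i \<le> z \<Longrightarrow> i < k"
    using pattern_shape[OF ex m] by metis
  obtain n h where h: "pattern n \<pi>" "strict_mono_on {1..n} h" "h ` {1..n} = R"
    "\<And>i. i \<in> {1..n} \<Longrightarrow> g (h i) = h (\<pi> i)" "\<And>i. i \<in> {1..n} \<Longrightarrow> \<pi> i \<in> {1..n}"
    using exhibits_onE[OF exR] by metis
  have nm: "n = m" using pattern_period_unique[OF h(1) m(1)] .
  note h = h[unfolded nm]
  have sub: "R \<subseteq> {lo..hi}" using exR by (auto simp: exhibits_on_def)
  have hR: "h i \<in> R" if "i \<in> {1..m}" for i using h(3) that by blast
  note hle = strict_mono_on_less_eq[OF h(2)]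
  note hless = strict_mono_on_less[OF h(2)]
  have idx: "1 \<in> {1..m}" "k \<in> {1..m}" "z \<in> {1..m}" "z + 1 \<in> {1..m}" "m \<in> {1..m}"
    using kz by auto
  have sub': "{h 1..h m} \<subseteq> {lo..hi}" using sub hR[OF idx(1)] hR[OF idx(5)] by auto
  have cont: "continuous_on {h 1..h m} g"
    using g sub' by (auto simp: interval_map_def intro: continuous_on_subset)
  have ord: "h 1 \<le> h k" "h k \<le> h z" "h z < h (z + 1)" "h (z + 1) \<le> h m"
    using hle[OF idx(1,2)] hle[OF idx(2,3)] hless[OF idx(3,4)] hle[OF idx(4,5)] kz by auto
  have gz: "h (z + 1) \<le> g (h z)" "g (h (z + 1)) \<le> h z"
    using hle[OF idx(4) h(5)[OF idx(3)]] hle[OF h(5)[OF idx(4)] idx(3)] h(4)[OF idx(3)] h(4)[OF idx(4)]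
      up[of z] down[of "z + 1"] kz by auto
  have "\<exists>x\<ge>h z. x \<le> h (z + 1) \<and> g x - x = 0"
    using gz ord by (intro IVT2' continuous_intros continuous_on_subset[OF cont]) auto
  then obtain b where b: "h z \<le> b" "b \<le> h (z + 1)" "g b = b" by auto
  then have b': "h z < b" "b < h (z + 1)"
    using gz ord by (cases "b = h z"; cases "b = h (z + 1)"; simp)+
  interpret G: folded g "h 1" "h k" b "h m"
    by unfold_locales (use ord b b' cont kz h(4)[OF idx(2)] h(4)[OF idx(5)] in auto)
  have side: "h i < b \<and> i \<le> z \<or> b < h i \<and> z < i" if "i \<in> {1..m}" for i
    using hle[OF that idx(3)] hle[OF idx(4) that] b' by (cases "i \<le> z") auto
  have sR: "sided_cycle g b R"
    unfolding sided_cycle_def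
  proof (intro conjI ballI exhibits_on_bij[OF exR])
    fix y assume "y \<in> R"
    then obtain i where i: "i \<in> {1..m}" "y = h i" using h(3) by blast
    show "y < b \<and> y < g y \<or> b < y \<and> g y < b"
    proof (cases "i \<le> z")
      case True
      then show ?thesis
        using side[OF i(1)] up[of i] hless[OF i(1) h(5)[OF i(1)]] h(4)[OF i(1)] i by auto
    next
      case False
      then show ?thesis
        using side[OF i(1)] side[OF h(5)[OF i(1)]] down[of i] h(4)[OF i(1)] i by auto
    qed
  qed
  have adm: "G.admissible R"
    unfolding G.admissible_def
  proof (intro conjI ballI impI sR)
    show "R \<subseteq> {h 1..h m}"
      using h(3) hle[OF idx(1)] hle[OF _ idx(5)] by auto
    fix y assume y: "y \<in> R" "y < b" "g y < b"
    then obtain i where i: "i \<in> {1..m}" "y = h i" using h(3) by blast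
    have "i \<le> z" "\<pi> i \<le> z"
      using side[OF i(1)] side[OF h(5)[OF i(1)]] h(4)[OF i(1)] i y by auto
    then show "y < h k" using mid[of i] hless[OF i(1) idx(2)] i by auto
  qed
  show "exhibits g lo hi (gamma_pattern p q)"
  proof (cases "q = 2 * p")
    case True
    then have "p = 1" using pq by simp
    have "h 1 \<le> g (g (h 1))"
      using h(4)[OF idx(1)] h(4)[OF h(5)[OF idx(1)]] hle[OF idx(1) h(5)[OF h(5)[OF idx(1)]]]
        h(5)[OF h(5)[OF idx(1)]] by auto
    from G.period_two[OF g sub' this] True \<open>p = 1\<close> show ?thesis by (simp add: exhibits_def)
  next
    case False
    define n where "n = q - p"
    have n: "p < n" "q = n + p" using False pq by (auto simp: n_def)
    have cop: "coprime p n" using coprime_diff_right[OF pq(3)] pq(2) by (simp add: n_def)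
    have y: "h 1 \<in> R" using hR idx by blast
    let ?l = "card (left_part b R)" and ?r = "card (right_part b R)"
    have l0: "0 < ?l" using sided_cycle_parts_nonempty(1)[OF sR] sided_cycleD(1)[OF sR] y
      by (auto simp: card_gt_0_iff)
    have "real ?r / real (?l + ?r) = real p / real (n + p)"
      using exhibits_on_sided_over_rotation[OF exR y sR] sided_cycle_card(1)[OF sR]
        pattern_over_rotation_number_eq[OF g exR y] orn n by simp
    from sided_rotation_ratio[OF this pq(1) l0]
    have "int n * int ?r - int p * int ?l = 0" by (simp flip: of_nat_mult)
    then have "\<not> G.frequency_gap n p"
      using adm l0 by force
    then obtain x where "gamma_orbit g b n p x" "\<And>j. j < n \<Longrightarrow> h 1 \<le> x j"
      "\<And>j. n - p \<le> j \<Longrightarrow> j < n \<Longrightarrow> g (x j) \<le> h m"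
      using G.gamma_orbit_or_gap[OF pq(1) n(1) cop] by blast
    then show ?thesis
      using G.gamma_orbit_exhibits_within[OF pq(1) _ cop _ _ _ sub', of x] n
      by (auto simp: exhibits_def)
  qed
qed

end

section \<open>The rotation pattern forces nothing else of its over-rotation number\<close>

context unimodal_folded begin

text \<open>
  Cutting \<open>f\<close> off at the largest value on a gamma orbit \<open>x\<close> makes the interval spanned by the orbit invariant, so that all other
  cycles have a position relative to \<open>x\<close>.
\<close>
context
  fixes n p :: nat and x :: "nat \<Rightarrow> real"
  assumes pn: "0 < p" "p < n" "coprime p n" and orb: "gamma_orbit f a n p x"
    and x_ge: "\<And>j. j < n \<Longrightarrow> 0 \<le> x j"
    and x_high: "\<And>j. n - p \<le> j \<Longrightarrow> j < n \<Longrightarrow> c \<le> x j" "\<And>j. n - p \<le> j \<Longrightarrow> j < n \<Longrightarrow> f (x j) \<le> 1"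
begin

definition truncated :: "real \<Rightarrow> real" where
  "truncated t = min (f t) (f (x (n - p)))"

lemma orbD:
  "\<And>i j. i < j \<Longrightarrow> j < n \<Longrightarrow> x i < x j" "\<And>j. j < n \<Longrightarrow> x j < a"
  "\<And>j. j < n - p \<Longrightarrow> f (x j) = x (j + p)"
  "\<And>j. n - p \<le> j \<Longrightarrow> j < n \<Longrightarrow> a < f (x j)"
  "\<And>j. n - p \<le> j \<Longrightarrow> j < n \<Longrightarrow> f (f (x j)) = x (j + p - n)"
  "\<And>i j. n - p \<le> i \<Longrightarrow> i < j \<Longrightarrow> j < n \<Longrightarrow> f (x j) < f (x i)"
  using orb unfolding gamma_orbit_def by blast+

lemma peak: "a < f (x (n - p))" "f (x (n - p)) \<le> 1" "f (f (x (n - p))) = x 0"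
  using orbD(4,5)[of "n - p"] x_high(2)[of "n - p"] pn by auto

lemma x_mono: "i \<le> j \<Longrightarrow> j < n \<Longrightarrow> x i \<le> x j"
  using orbD(1)[of i j] by (cases "i = j") auto

lemma truncated_low: "truncated t < a \<Longrightarrow> truncated t = f t"
  using peak(1) by (simp add: truncated_def min_def split: if_splits)

text \<open>
  From \<open>x (n - p)\<close>, whose image is the cut-off value, up to \<open>a\<close> the map \<open>f\<close> decreases.
\<close>
lemma truncated_high: "n - p \<le> j \<Longrightarrow> j < n \<Longrightarrow> x j \<le> t \<Longrightarrow> t < a \<Longrightarrow> truncated t = f t"
proof -
  assume j: "n - p \<le> j" "j < n" "x j \<le> t" "t < a"
  then have "x (n - p) \<le> t" using x_mono[of "n - p" j] by simp
  moreover have "c \<le> x (n - p)" using x_high(1)[of "n - p"] pn by simp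
  ultimately have "f t \<le> f (x (n - p))"
    using dec_less[of "x (n - p)" t] j a_less_B by (cases "x (n - p) = t") auto
  then show ?thesis by (simp add: truncated_def)
qed

lemma truncated_interval_map: "interval_map truncated (x 0) (f (x (n - p)))"
  unfolding interval_map_def
proof (intro conjI)
  have x0: "0 \<le> x 0" "x 0 < a" using x_ge[of 0] orbD(2)[of 0] pn by auto
  show "x 0 < f (x (n - p))" using x0 peak by simp
  show "continuous_on {x 0..f (x (n - p))} truncated"
    unfolding truncated_def using x0 peak
    by (intro continuous_intros continuous_on_subset[OF cont]) auto
  show "truncated ` {x 0..f (x (n - p))} \<subseteq> {x 0..f (x (n - p))}"
  proof clarify
    fix t assume t: "t \<in> {x 0..f (x (n - p))}"
    consider "t < a" | "t = a" | "a < t" by linarith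
    then have "x 0 \<le> f t"
    proof cases
      case 1
      then show ?thesis using left_up[of t] t x0 by simp
    next
      case 2
      then show ?thesis using g_a x0 by simp
    next
      case 3
      then show ?thesis
        using dec_less[of t "f (x (n - p))"] t peak c_less_a by (cases "t = f (x (n - p))") auto
    qed
    then show "truncated t \<in> {x 0..f (x (n - p))}" using x0 peak by (simp add: truncated_def)
  qed
qed

lemma truncated_gamma_orbit: "gamma_orbit truncated a n p x"
proof -
  have low: "truncated (x j) = f (x j)" if "j < n - p" for j
  proof -
    have "j + p < n" using that by simp
    then show ?thesis using orbD(3)[OF that] orbD(2)[of "j + p"] peak by (simp add: truncated_def)
  qed
  have high: "truncated (x j) = f (x j)" if "n - p \<le> j" "j < n" for j
    using truncated_high[OF that] orbD(2)[OF that(2)] by simp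
  have high2: "truncated (f (x j)) = f (f (x j))" if "n - p \<le> j" "j < n" for j
  proof -
    have "j + p - n < n" using that pn by simp
    then show ?thesis using orbD(5)[OF that] orbD(2)[of "j + p - n"] peak by (simp add: truncated_def)
  qed
  show ?thesis
    unfolding gamma_orbit_def using orbD low high high2 by auto
qed

lemma truncated_exhibits_gamma:
  "\<exists>P. exhibits_on truncated (x 0) (f (x (n - p))) P (gamma_pattern p (n + p))"
proof -
  have eq: "truncated (x j) = f (x j)" if "n - p \<le> j" "j < n" for j
    using truncated_high[OF that] orbD(2)[OF that(2)] by simp
  have "x ` {..<n} \<subseteq> {x 0..f (x (n - p))}"
    using x_mono[of 0] orbD(2) peak(1) by (force intro: less_imp_le)
  moreover have "truncated ` x ` {n - p..<n} \<subseteq> {x 0..f (x (n - p))}"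
  proof clarify
    fix j assume j: "j \<in> {n - p..<n}"
    then have "f (x j) \<le> f (x (n - p))" using orbD(6)[of "n - p" j] by (cases "j = n - p") auto
    moreover have "x 0 < a" "a < f (x j)" using orbD(2)[of 0] orbD(4)[of j] j pn by auto
    ultimately show "truncated (x j) \<in> {x 0..f (x (n - p))}" using eq[of j] j by auto
  qed
  ultimately have "x ` {..<n} \<union> truncated ` x ` {n - p..<n} \<subseteq> {x 0..f (x (n - p))}" by blast
  from gamma_orbit_exhibits[OF pn(1) _ pn(3) truncated_gamma_orbit this] pn show ?thesis by auto
qed

text \<open>
  As in \<open>position_gain\<close>, a step gains at least \<open>p\<close> positions relative to \<open>x\<close>, now because \<open>f\<close> is monotone on
  either side of \<open>c\<close>. On a cycle with frequency \<open>p / n\<close> the gain is exactly \<open>p\<close>, so the return map takes each class \<open>C j\<close> of points in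
  position \<open>j\<close> onto the next class \<open>C ((j + p) mod n)\<close>. It is increasing on each class and therefore respects the maxima \<open>v j\<close>,
  which form a gamma orbit inside the cycle. A cycle has no smaller invariant part.
\<close>
lemma truncated_cycle_is_gamma:
  assumes ex: "exhibits_on truncated (x 0) (f (x (n - p))) Q \<theta>"
    and m: "pattern m \<theta>" "2 \<le> m" and y: "y \<in> Q"
    and orn: "over_rotation_number truncated y = real p / real (n + p)"
  shows "\<theta> = gamma_pattern p (n + p)"
proof -
  let ?g = truncated
  have n0: "0 < n" using pn by simp
  have sub: "Q \<subseteq> {x 0..f (x (n - p))}" using ex by (auto simp: exhibits_on_def)
  have Q01: "0 \<le> z" "z \<le> 1" if "z \<in> Q" for z
    using that sub x_ge[OF n0] peak(2) by force+
  have ga: "?g a = a" using g_a peak(1) by (simp add: truncated_def)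
  have sQ: "sided_cycle ?g a Q"
    unfolding sided_cycle_def
  proof (intro conjI ballI exhibits_on_bij[OF ex])
    fix z assume z: "z \<in> Q"
    have "z \<noteq> a" using exhibits_on_no_fixed_point[OF ex m z] ga by auto
    then show "z < a \<and> z < ?g z \<or> a < z \<and> ?g z < a"
      using left_up[of z] right_down[of z] Q01[OF z] peak(1)
      by (cases z a rule: linorder_cases) (auto simp: truncated_def)
  qed
  let ?S = "left_part a Q" and ?R = "left_return ?g a" and ?w = "\<lambda>z. if a < ?g z then 1 else (0::nat)"
  let ?pos = "position x n"
  have fin: "finite ?S" using sided_cycleD(1)[OF sQ] by simp
  have S0: "?S \<noteq> {}" using sided_cycle_parts_nonempty(1)[OF sQ] y by blast
  have xS: "x 0 \<le> z" "z < a" "z \<in> Q" if "z \<in> ?S" for z using that sub by auto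
  have pos: "?pos z < n" "x (?pos z) \<le> z" if "z \<in> ?S" for z
    using position[OF n0, of x z] xS[OF that] by auto
  have RS: "?R z \<in> ?S" if "z \<in> ?S" for z using left_return_in[OF sQ that] .
  have gain: "?pos z + p \<le> ?pos (?R z) + n * ?w z" if z: "z \<in> ?S" for z
  proof (cases "a < ?g z")
    case False
    then have R: "?R z = ?g z" by (simp add: left_return_def)
    then have lt: "?g z < a" using RS[OF z] by auto
    then have gz: "?g z = f z" by (rule truncated_low)
    have zc: "z < c" using dec_less[of z a] g_a a_less_B lt gz xS[OF z] by force
    have "f (x (?pos z)) \<le> f z"
      using inc_less[of "x (?pos z)" z] pos[OF z] zc x_ge[OF pos(1)[OF z]] by (cases "x (?pos z) = z") auto
    then have "\<not> n - p \<le> ?pos z" using orbD(4)[of "?pos z"] pos[OF z] lt gz by auto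
    moreover from this have "x (?pos z + p) \<le> ?g z"
      using orbD(3)[of "?pos z"] \<open>f (x (?pos z)) \<le> f z\<close> gz by simp
    ultimately have "?pos z + p \<le> ?pos (?g z)" by (intro position_ge) auto
    then show ?thesis using R by simp
  next
    case True
    then have R: "?R z = ?g (?g z)" by (simp add: left_return_def)
    then have lt: "?g (?g z) < a" using RS[OF z] by auto
    then have ggz: "?g (?g z) = f (?g z)" by (rule truncated_low)
    show ?thesis
    proof (cases "?pos z < n - p")
      case True
      then show ?thesis using \<open>a < ?g z\<close> by simp
    next
      case False
      then have j: "n - p \<le> ?pos z" "?pos z < n" using pos[OF z] by auto
      have gz: "?g z = f z" using truncated_high[OF j pos(2)[OF z]] xS[OF z] by simp
      have "f z \<le> f (x (?pos z))"
        using dec_less[of "x (?pos z)" z] pos[OF z] x_high(1)[OF j] xS[OF z] a_less_B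
        by (cases "x (?pos z) = z") auto
      then have "f (f (x (?pos z))) \<le> f (f z)"
        using dec_less[of "f z" "f (x (?pos z))"] True gz x_high(2)[OF j] c_less_a
        by (cases "f z = f (x (?pos z))") auto
      then have "x (?pos z + p - n) \<le> ?g (?g z)" using orbD(5)[OF j] ggz gz by simp
      then have "?pos z + p - n \<le> ?pos (?g (?g z))" using j pn by (intro position_ge) auto
      then show ?thesis using R True by simp
    qed
  qed
  have total: "n * (\<Sum>z\<in>?S. ?w z) = p * card ?S"
    unfolding sided_cycle_crossing_sum[OF sQ]
  proof (rule sided_rotation_ratio)
    show "real (card (right_part a Q)) / real (card ?S + card (right_part a Q)) = real p / real (n + p)"
      using exhibits_on_sided_over_rotation[OF ex y sQ] sided_cycle_card(1)[OF sQ] orn by simp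
    show "0 < card ?S" using S0 fin by (simp add: card_gt_0_iff)
  qed (rule pn)
  have tight: "?pos (?R z) + n * ?w z = ?pos z + p" if "z \<in> ?S" for z
    using drift_tight[OF fin left_return_bij[OF sQ] gain total that] .
  have wrap: "a < ?g z \<longleftrightarrow> n - p \<le> ?pos z" if z: "z \<in> ?S" for z
    using tight[OF z] pos(1)[OF RS[OF z]] by (auto split: if_splits)
  have posR: "?pos (?R z) = (?pos z + p) mod n" if z: "z \<in> ?S" for z
  proof -
    have "(?pos z + p) mod n = (?pos (?R z) + n * ?w z) mod n" using tight[OF z] by simp
    then show ?thesis using pos(1)[OF RS[OF z]] by simp
  qed
  have same: "?pos u = ?pos v" if "u \<in> ?S" "v \<in> ?S" "?pos (?R u) = ?pos (?R v)" for u v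
    using tight[OF that(1)] tight[OF that(2)] that(3) pos(1)[OF that(1)] pos(1)[OF that(2)]
    by (cases "a < ?g u"; cases "a < ?g v") auto
  have highf: "?g z = f z" if "z \<in> ?S" "n - p \<le> ?pos z" for z
    using truncated_high[OF that(2) pos[OF that(1)]] xS[OF that(1)] by simp
  have Rmono: "?R u < ?R v" if uv: "u \<in> ?S" "v \<in> ?S" "?pos u = ?pos v" "u < v" for u v
  proof (cases "n - p \<le> ?pos u")
    case False
    then have nw: "\<not> a < ?g u" "\<not> a < ?g v" using wrap uv by auto
    then have R: "?R u = ?g u" "?R v = ?g v" by (auto simp: left_return_def)
    then have lt: "?g u < a" "?g v < a" using RS[OF uv(1)] RS[OF uv(2)] by auto
    then have eq: "?g u = f u" "?g v = f v" using truncated_low by auto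
    have "v < c" using dec_less[of v a] g_a a_less_B lt eq xS[OF uv(2)] by force
    then show ?thesis using inc_less[of u v] uv xS[OF uv(1)] x_ge[OF n0] R eq by simp
  next
    case True
    then have w: "a < ?g u" "a < ?g v" using wrap uv by auto
    then have R: "?R u = ?g (?g u)" "?R v = ?g (?g v)" by (auto simp: left_return_def)
    then have lt: "?g (?g u) < a" "?g (?g v) < a" using RS[OF uv(1)] RS[OF uv(2)] by auto
    have eq: "?g u = f u" "?g v = f v" using highf[OF uv(1)] highf[OF uv(2)] True uv by auto
    have eq2: "?g (?g u) = f (?g u)" "?g (?g v) = f (?g v)" using truncated_low lt by auto
    have cu: "c \<le> u" using x_high(1)[OF True pos(1)[OF uv(1)]] pos(2)[OF uv(1)] by simp
    have "f v < f u" using dec_less[OF cu uv(4)] xS[OF uv(2)] a_less_B by simp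
    moreover have "f u \<le> 1" using maps[of u] cu c_pos xS[OF uv(1)] a_less_B by simp
    ultimately have "f (f u) < f (f v)" using dec_less[of "f v" "f u"] w eq c_less_a by simp
    then show ?thesis using R eq eq2 by simp
  qed
  define C where "C j = {z\<in>?S. ?pos z = j}" for j
  have Cne: "C j \<noteq> {}" if "j < n" for j
  proof -
    obtain z where z: "z \<in> ?S" using S0 by blast
    have "j \<in> {j. C j \<noteq> {}}"
    proof (rule rotation_invariant_all[OF pn(3) n0 _ pos(1)[OF z] _ that])
      show "?pos z \<in> {j. C j \<noteq> {}}" using z by (auto simp: C_def)
      fix i assume "i \<in> {j. C j \<noteq> {}}"
      then obtain u where "u \<in> ?S" "?pos u = i" by (auto simp: C_def)
      then have "?R u \<in> C ((i + p) mod n)" using RS posR by (auto simp: C_def)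
      then show "(i + p) mod n \<in> {j. C j \<noteq> {}}" by blast
    qed
    then show ?thesis by simp
  qed
  have Cfin: "finite (C j)" for j by (rule finite_subset[OF _ fin]) (auto simp: C_def)
  define v where "v j = Max (C j)" for j
  have vC: "v j \<in> C j" if "j < n" for j unfolding v_def using Max_in[OF Cfin Cne[OF that]] .
  have v: "v j \<in> ?S" "?pos (v j) = j" if "j < n" for j using vC[OF that] by (auto simp: C_def)
  have Rv: "?R (v j) = v ((j + p) mod n)" if j: "j < n" for j
  proof -
    have "?R (v j) \<in> C ((j + p) mod n)" using RS[OF v(1)[OF j]] posR[OF v(1)[OF j]] v(2)[OF j] by (simp add: C_def)
    moreover have "z \<le> ?R (v j)" if z: "z \<in> C ((j + p) mod n)" for z
    proof -
      have "z \<in> ?S" using z by (simp add: C_def)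
      then have "z \<in> ?R ` ?S" by (simp only: bij_betw_imp_surj_on[OF left_return_bij[OF sQ]])
      then obtain u where u: "u \<in> ?S" "z = ?R u" by blast
      then have "?pos (?R u) = ?pos (?R (v j))"
        using z posR[OF v(1)[OF j]] v(2)[OF j] by (simp add: C_def)
      then have "?pos u = j" using same[OF u(1) v(1)[OF j]] v(2)[OF j] by simp
      then have "u \<le> v j" unfolding v_def using u Cfin by (intro Max_ge) (auto simp: C_def)
      then show ?thesis
        using Rmono[OF u(1) v(1)[OF j]] \<open>?pos u = j\<close> v(2)[OF j] u(2) by (cases "u = v j") auto
    qed
    ultimately show ?thesis unfolding v_def using Cfin by (intro Max_eqI[symmetric]) auto
  qed
  have go: "gamma_orbit ?g a n p v"
    unfolding gamma_orbit_def
  proof (intro conjI allI impI)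
    show "v i < v j" if "i < j" "j < n" for i j
      using position_less_less[OF n0, of x "v i" "v j"] v[of i] v[of j] xS(1)[of "v i"] xS(1)[of "v j"] that by simp
    show "v j < a" if "j < n" for j using v(1)[OF that] by simp
    show "?g (v j) = v (j + p)" if "j < n - p" for j
    proof -
      have j: "j < n" "j + p < n" using that by auto
      have "\<not> a < ?g (v j)" using wrap[OF v(1)[OF j(1)]] v(2)[OF j(1)] that by simp
      then show ?thesis using Rv[OF j(1)] j(2) by (simp add: left_return_def)
    qed
    fix j assume j: "n - p \<le> j" "j < n"
    show w: "a < ?g (v j)" using wrap[OF v(1)[OF j(2)]] v(2)[OF j(2)] j by simp
    have "n \<le> j + p" "j + p - n < n" using j pn by auto
    then show "?g (?g (v j)) = v (j + p - n)" using Rv[OF j(2)] w by (simp add: left_return_def le_mod_geq)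
  next
    fix i j assume ij: "n - p \<le> i" "i < j" "j < n"
    have i: "i < n" using ij by simp
    have "v i < v j"
      using position_less_less[OF n0, of x "v i" "v j"] v[OF i] v[OF ij(3)] xS(1)[of "v i"] xS(1)[of "v j"] ij by simp
    moreover have "c \<le> v i" using x_high(1)[OF ij(1) i] pos(2)[OF v(1)[OF i]] v(2)[OF i] by simp
    ultimately have "f (v j) < f (v i)" using dec_less[of "v i" "v j"] xS(2)[OF v(1)[OF ij(3)]] a_less_B by simp
    then show "?g (v j) < ?g (v i)"
      using highf[OF v(1)[OF i]] highf[OF v(1)[OF ij(3)]] v(2)[OF i] v(2)[OF ij(3)] ij by simp
  qed
  let ?P = "v ` {..<n} \<union> ?g ` v ` {n - p..<n}"
  have PQ: "?P \<subseteq> Q" using v(1) sided_cycleD(4)[OF sQ] by auto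
  have exP: "exhibits_on ?g (x 0) (f (x (n - p))) ?P (gamma_pattern p (n + p))"
    using sub pn by (intro gamma_orbit_exhibits[OF pn(1) _ pn(3) go] order_trans[OF PQ]) auto
  have "v 0 \<in> ?P" using n0 by blast
  then have "?P = Q"
    using exhibits_on_periodic(1)[OF exP, of "v 0"] exhibits_on_periodic(1)[OF ex, of "v 0"] PQ by blast
  with exP have "exhibits_on ?g (x 0) (f (x (n - p))) Q (gamma_pattern p (n + p))" by simp
  from exhibits_on_unique[OF ex this] show ?thesis .
qed

end

end

section \<open>Uniqueness of the over-twist pattern\<close>

lemma gamma_pattern_pattern_diff:
  assumes "0 < p" "2 * p \<le> q" "coprime p q"
  shows "pattern q (gamma_pattern p q)"
proof -
  have "q = (q - p) + p" using assms by simp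
  moreover have "coprime p (q - p)" using assms by (intro coprime_diff_right) auto
  ultimately show ?thesis using gamma_pattern_pattern[of p "q - p"] assms by simp
qed

lemma gamma_pattern_unimodal:
  assumes pq: "0 < p" "2 * p \<le> q" "coprime p q"
  shows "unimodal_pattern (gamma_pattern p q)"
proof (cases "q = 2 * p")
  case True
  then have "p = 1" using pq by simp
  interpret unimodal_folded "climbing_tent 2" "1 - 1 / real 2" "real 2 / real (2 + 1)"
    by (rule climbing_tent_unimodal(1)) simp
  show ?thesis
    using exhibits_two_cycle climbing_tent_unimodal(2)[of 2] True \<open>p = 1\<close>
    by (auto simp: unimodal_pattern_def exhibits_def)
next
  case False
  define n where "n = q - p"
  have n: "p < n" "q = n + p" using False pq by (auto simp: n_def)
  have cop: "coprime p n" using coprime_diff_right[OF pq(3)] pq(2) by (simp add: n_def)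
  have n2: "2 \<le> n" using n pq by simp
  interpret unimodal_folded "climbing_tent n" "1 - 1 / real n" "real n / real (n + 1)"
    by (rule climbing_tent_unimodal(1)[OF n2])
  obtain x where x: "gamma_orbit (climbing_tent n) (real n / real (n + 1)) n p x" "\<And>j. j < n \<Longrightarrow> 0 \<le> x j"
    "\<And>j. n - p \<le> j \<Longrightarrow> j < n \<Longrightarrow> climbing_tent n (x j) \<le> 1"
    using climbing_tent_gamma_orbit[OF pq(1) n(1) cop] by blast
  have "\<exists>P. exhibits_on (climbing_tent n) 0 1 P (gamma_pattern p (n + p))"
    by (rule gamma_orbit_exhibits_within[OF pq(1) _ cop x]) (use n in auto)
  then show ?thesis
    using climbing_tent_unimodal(2)[OF n2] n by (auto simp: unimodal_pattern_def exhibits_def)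
qed

lemma gamma_pattern_cycle_number:
  assumes "0 < p" "2 * p \<le> q" "coprime p q"
    and "exhibits_on f lo hi P (gamma_pattern p q)" "y \<in> P"
  shows "over_rotation_number f y = real p / real q" "f y \<noteq> y"
proof -
  have q: "q = (q - p) + p" "p \<le> q - p" using assms by auto
  moreover have "coprime p (q - p)" using assms by (intro coprime_diff_right) auto
  ultimately show "over_rotation_number f y = real p / real q" "f y \<noteq> y"
    using gamma_pattern_over_rotation[of p "q - p" f lo hi P y] assms by auto
qed

lemma gamma_pattern_number:
  assumes pq: "0 < p" "2 * p \<le> q" "coprime p q"
  shows "pattern_over_rotation_number (gamma_pattern p q) = real p / real q"
proof -
  obtain f P where f: "unimodal_map f" "exhibits_on f 0 1 P (gamma_pattern p q)"
    using gamma_pattern_unimodal[OF pq] by (auto simp: unimodal_pattern_def exhibits_def)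
  obtain y where y: "y \<in> P" using exhibits_on_bij(2)[OF f(2)] by blast
  have "interval_map f 0 1" using f(1) by (simp add: unimodal_map_def)
  from pattern_over_rotation_number_eq[OF this f(2) y] gamma_pattern_cycle_number(1)[OF pq f(2) y]
  show ?thesis by simp
qed

text \<open>
  A forced pattern of the same over-rotation number occurs in the truncated map, where only the given one does; for
  \<open>\<rho> = 1/2\<close> the map \<open>t \<mapsto> 1 - t\<close> plays the same part.
\<close>
lemma gamma_pattern_over_twist:
  assumes pq: "0 < p" "2 * p \<le> q" "coprime p q"
  shows "over_twist_pattern (gamma_pattern p q)"
  unfolding over_twist_pattern_def
proof (intro conjI notI)
  show "\<exists>n\<ge>2. pattern n (gamma_pattern p q)"
    using gamma_pattern_pattern_diff[OF pq] pq by (intro exI[of _ q]) auto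
next
  assume "\<exists>m \<theta>. 2 \<le> m \<and> pattern m \<theta> \<and> \<theta> \<noteq> gamma_pattern p q \<and>
    pattern_over_rotation_number \<theta> = pattern_over_rotation_number (gamma_pattern p q) \<and>
    forces (gamma_pattern p q) \<theta>"
  then obtain m \<theta> where m: "pattern m \<theta>" "2 \<le> m" and ne: "\<theta> \<noteq> gamma_pattern p q"
    and orn: "pattern_over_rotation_number \<theta> = real p / real q"
    and forced: "forces (gamma_pattern p q) \<theta>"
    using gamma_pattern_number[OF pq] by auto
  show False
  proof (cases "q = 2 * p")
    case True
    then have "p = 1" "q = 2" using pq by auto
    let ?f = "\<lambda>t::real. 1 - t"
    have "interval_map ?f 0 1" by (auto simp: interval_map_def intro!: continuous_intros)
    moreover have "exhibits_on ?f 0 1 {0, ?f 0} (gamma_pattern 1 2)"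
      by (rule two_cycle_exhibits) auto
    ultimately have "exhibits ?f 0 1 \<theta>"
      using forced \<open>p = 1\<close> \<open>q = 2\<close> unfolding forces_def exhibits_def by blast
    then obtain Q where Q: "exhibits_on ?f 0 1 Q \<theta>" by (auto simp: exhibits_def)
    obtain y where y: "y \<in> Q" using exhibits_on_bij(2)[OF Q] by blast
    have fy: "?f y \<noteq> y" by (rule exhibits_on_no_fixed_point[OF Q m y])
    have yQ: "?f y \<in> Q" using exhibits_on_bij(3)[OF Q] y by (auto dest: bij_betwE)
    have Q01: "Q \<subseteq> {0..1}" using Q by (auto simp: exhibits_on_def)
    have ex2: "exhibits_on ?f 0 1 {y, ?f y} (gamma_pattern 1 2)"
      by (rule two_cycle_exhibits) (use fy y yQ Q01 in auto)
    have "{y, ?f y} = Q"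
      using exhibits_on_periodic(1)[OF ex2, of y] exhibits_on_periodic(1)[OF Q y] by simp
    with ex2 have "exhibits_on ?f 0 1 Q (gamma_pattern 1 2)" by simp
    from exhibits_on_unique[OF Q this] ne \<open>p = 1\<close> \<open>q = 2\<close> show False by simp
  next
    case False
    define n where "n = q - p"
    have n: "p < n" "q = n + p" using False pq by (auto simp: n_def)
    have cop: "coprime p n" using coprime_diff_right[OF pq(3)] pq(2) by (simp add: n_def)
    have n2: "2 \<le> n" using n pq by simp
    let ?f = "climbing_tent n"
    interpret unimodal_folded ?f "1 - 1 / real n" "real n / real (n + 1)"
      by (rule climbing_tent_unimodal(1)[OF n2])
    obtain x where x: "gamma_orbit ?f (real n / real (n + 1)) n p x" "\<And>j. j < n \<Longrightarrow> 0 \<le> x j"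
      "\<And>j. n - p \<le> j \<Longrightarrow> j < n \<Longrightarrow> 1 - 1 / real n \<le> x j"
      "\<And>j. n - p \<le> j \<Longrightarrow> j < n \<Longrightarrow> ?f (x j) \<le> 1"
      using climbing_tent_gamma_orbit[OF pq(1) n(1) cop] by blast
    note hyps = pq(1) n(1) cop x
    let ?g = "truncated n p x"
    have g: "interval_map ?g (x 0) (?f (x (n - p)))" by (rule truncated_interval_map[OF hyps])
    have "exhibits ?g (x 0) (?f (x (n - p))) (gamma_pattern p q)"
      using truncated_exhibits_gamma[OF hyps] n by (simp add: exhibits_def)
    then have "exhibits ?g (x 0) (?f (x (n - p))) \<theta>" using forced g by (simp add: forces_def)
    then obtain Q where Q: "exhibits_on ?g (x 0) (?f (x (n - p))) Q \<theta>" by (auto simp: exhibits_def)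
    obtain y where y: "y \<in> Q" using exhibits_on_bij(2)[OF Q] by blast
    have "over_rotation_number ?g y = real p / real (n + p)"
      using pattern_over_rotation_number_eq[OF g Q y] orn n by simp
    from truncated_cycle_is_gamma[OF hyps Q m y this] ne n show False by simp
  qed
qed

lemma unimodal_over_twist_pattern_is_gamma:
  assumes pq: "0 < p" "2 * p \<le> q" "coprime p q"
    and \<pi>: "unimodal_pattern \<pi>" "over_twist_pattern \<pi>" "pattern_over_rotation_number \<pi> = real p / real q"
  shows "\<pi> = gamma_pattern p q"
proof (rule ccontr)
  assume "\<pi> \<noteq> gamma_pattern p q"
  obtain m where m: "pattern m \<pi>" "2 \<le> m" using \<pi>(2) by (auto simp: over_twist_pattern_def)
  obtain f P where f: "unimodal_map f" "exhibits_on f 0 1 P \<pi>"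
    using \<pi>(1) by (auto simp: unimodal_pattern_def exhibits_def)
  obtain c a where "unimodal_folded f c a" using unimodal_map_folded[OF f(1)] .
  then interpret unimodal_folded f c a .
  have "forces \<pi> (gamma_pattern p q)" by (rule pattern_forces_gamma[OF f(2) m pq \<pi>(3)])
  moreover have "pattern q (gamma_pattern p q)" "2 \<le> q" using gamma_pattern_pattern_diff[OF pq] pq by auto
  ultimately show False
    using \<pi>(2,3) gamma_pattern_number[OF pq] \<open>\<pi> \<noteq> _\<close> unfolding over_twist_pattern_def by metis
qed

section \<open>The over-rotation interval\<close>

text \<open>
  Every rational between the infimum of the over-rotation numbers and \<open>1/2\<close> is an over-rotation number.
\<close>
lemma unimodal_over_rotation_interval:
  assumes f: "unimodal_map f" and pq: "0 < p" "2 * p \<le> q" "coprime p q"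
    and ex: "exhibits_on f 0 1 P (gamma_pattern p q)"
  shows "\<exists>\<mu>. over_rotation_interval f 0 1 = {\<mu>..1/2} \<and> \<mu> \<le> real p / real q"
proof -
  obtain c a where "unimodal_folded f c a" using unimodal_map_folded[OF f] .
  then interpret unimodal_folded f c a .
  define S where "S = {over_rotation_number f y | y. y \<in> {0..1} \<and> nonfixed_periodic f y}"
  have gamma_in: "real k / real m \<in> S"
    if km: "0 < k" "2 * k \<le> m" "coprime k m" "exhibits_on f 0 1 R (gamma_pattern k m)" for k m R
  proof -
    obtain y where y: "y \<in> R" using exhibits_on_bij(2)[OF km(4)] by blast
    have "nonfixed_periodic f y"
      unfolding nonfixed_periodic_def
      using exhibits_on_periodic(2)[OF km(4) y] gamma_pattern_cycle_number(2)[OF km y] by blast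
    moreover have "y \<in> {0..1}" using km(4) y by (auto simp: exhibits_on_def)
    moreover note gamma_pattern_cycle_number(1)[OF km y]
    ultimately show ?thesis unfolding S_def by force
  qed
  have bounds: "0 \<le> s" "s \<le> 1/2" if "s \<in> S" for s
  proof -
    obtain y where y: "y \<in> {0..1}" "nonfixed_periodic f y" "s = over_rotation_number f y"
      using \<open>s \<in> S\<close> by (auto simp: S_def)
    obtain k where k: "0 < k" "(f ^^ k) y = y" using y(2) by (auto simp: nonfixed_periodic_def)
    have sQ: "sided_cycle f a (forward_orbit f y)"
      using cycle_admissible[OF y(1,2)] by (simp add: admissible_def)
    have "s = real (card (right_part a (forward_orbit f y))) / real (card (forward_orbit f y))"
      using over_rotation_number_sided[OF k sQ] y(3) by simp
    moreover have "2 * card (right_part a (forward_orbit f y)) \<le> card (forward_orbit f y)"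
      using sided_cycle_card[OF sQ] by simp
    ultimately show "0 \<le> s" "s \<le> 1/2" by (auto simp: divide_le_eq)
  qed
  have pS: "real p / real q \<in> S" by (rule gamma_in[OF pq ex])
  have bdd: "bdd_below S" using bounds(1) by (rule bdd_belowI)
  define \<mu> where "\<mu> = Inf S"
  have "closure S = {\<mu>..1/2}"
  proof (rule antisym)
    have "S \<subseteq> {\<mu>..1/2}" using cInf_lower[OF _ bdd] bounds(2) by (auto simp: \<mu>_def)
    then show "closure S \<subseteq> {\<mu>..1/2}" by (rule closure_minimal) simp
  next
    have dense: "u \<in> S" if u: "u \<in> \<rat>" "\<mu> < u" "u < 1/2" for u
    proof -
      have "0 \<le> \<mu>" unfolding \<mu>_def using pS bounds(1) by (intro cInf_greatest) auto
      then have "0 < u" using u by simp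
      obtain k m :: nat where km: "m \<noteq> 0" "\<bar>u\<bar> = real k / real m" "coprime k m"
        using Rats_abs_nat_div_natE[OF u(1)] .
      have u_eq: "u = real k / real m" using km(2) \<open>0 < u\<close> by simp
      have k: "0 < k" using \<open>0 < u\<close> u_eq by (cases k) auto
      have "real (2 * k) < real m" using u(3) km(1) unfolding u_eq by (simp add: field_simps)
      then have m: "2 * k \<le> m" by linarith
      obtain s where s: "s \<in> S" "s < u" using u(2) pS cInf_less_iff[of S u] bdd unfolding \<mu>_def by blast
      have "\<exists>R. exhibits_on f 0 1 R (gamma_pattern k m)"
      proof (rule exhibits_gamma[OF k m km(3)])
        fix e :: real assume "0 < e"
        then show "\<exists>y\<in>{0..1}. nonfixed_periodic f y \<and> over_rotation_number f y < real k / real m + e"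
          using s unfolding S_def u_eq by force
      qed
      then show ?thesis unfolding u_eq using gamma_in[OF k m km(3)] by blast
    qed
    show "{\<mu>..1/2} \<subseteq> closure S"
    proof
      fix t assume t: "t \<in> {\<mu>..1/2}"
      show "t \<in> closure S"
      proof (cases "t = \<mu>")
        case True
        then show ?thesis unfolding \<mu>_def using pS bdd by (auto intro: closure_contains_Inf)
      next
        case False
        then have lt: "\<mu> < t" using t by simp
        show ?thesis
          unfolding closure_approachable
        proof (intro allI impI)
          fix e :: real assume "0 < e"
          then have "max \<mu> (t - e) < t" using lt by simp
          then obtain u where u: "u \<in> \<rat>" "max \<mu> (t - e) < u" "u < t" using Rats_dense_in_real by blast
          then have "u \<in> S" using t by (intro dense) auto
          moreover have "dist u t < e" using u by (simp add: dist_real_def)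
          ultimately show "\<exists>u\<in>S. dist u t < e" by blast
        qed
      qed
    qed
  qed
  moreover have "\<mu> \<le> real p / real q" unfolding \<mu>_def using pS bdd by (rule cInf_lower)
  ultimately show ?thesis unfolding over_rotation_interval_def S_def[symmetric] by blast
qed

text \<open>
  The end point \<open>\<mu>\<close> is a limit of over-rotation numbers; this is all that \<open>exhibits_gamma\<close> asks for.
\<close>
lemma low_over_rotation_interval_gamma:
  assumes f: "unimodal_map f" and pq: "0 < p" "2 * p \<le> q" "coprime p q"
    and I: "over_rotation_interval f 0 1 = {\<mu>..1/2}" "\<mu> \<le> real p / real q"
  shows "\<exists>P. exhibits_on f 0 1 P (gamma_pattern p q)"
proof -
  obtain c a where "unimodal_folded f c a" using unimodal_map_folded[OF f] .
  then interpret unimodal_folded f c a .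
  show ?thesis
  proof (rule exhibits_gamma[OF pq])
    fix e :: real assume e: "0 < e"
    have "real p / real q \<le> 1/2" using pq by (simp add: field_simps)
    then have "\<mu> \<le> 1/2" using I(2) by linarith
    then have "\<mu> \<in> over_rotation_interval f 0 1" using I(1) by simp
    then obtain s where "s \<in> {over_rotation_number f y | y. y \<in> {0..1} \<and> nonfixed_periodic f y}" "dist s \<mu> < e"
      unfolding over_rotation_interval_def closure_approachable using e by blast
    then show "\<exists>y\<in>{0..1}. nonfixed_periodic f y \<and> over_rotation_number f y < real p / real q + e"
      using I(2) by (force simp: dist_real_def)
  qed
qed

theorem lemma2p1:
  fixes p q :: nat
  assumes "p > 0" and "q > 0" and "coprime p q" and "real p / real q \<le> 1 / 2"
  shows "{\<pi>. unimodal_pattern \<pi> \<and> over_twist_pattern \<pi> \<and>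
              pattern_over_rotation_number \<pi> = real p / real q} = {gamma_pattern p q} \<and>
         (\<forall>f. unimodal_map f \<longrightarrow>
            ((\<exists>\<mu>. over_rotation_interval f 0 1 = {\<mu>..1/2} \<and> \<mu> \<le> real p / real q)
             \<longleftrightarrow> (\<exists>P. exhibits_on f 0 1 P (gamma_pattern p q))))"
proof -
  have "real (2 * p) \<le> real q" using assms(2,4) by (simp add: field_simps)
  then have "2 * p \<le> q" by (simp only: of_nat_le_iff)
  note pq = assms(1) this assms(3)
  show ?thesis
    using unimodal_over_twist_pattern_is_gamma[OF pq] gamma_pattern_unimodal[OF pq]
      gamma_pattern_over_twist[OF pq] gamma_pattern_number[OF pq]
      unimodal_over_rotation_interval[OF _ pq] low_over_rotation_interval_gamma[OF _ pq]
    by blast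
qed

end
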